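(* Let $n\ge 1$. There are mutually inverse bijections $\Phi:\mathrm{MBPD}(n)\to\mathrm{RCP}(n)$ and $\Psi:\mathrm{RCP}(n)\to\mathrm{MBPD}(n)$ between the set of marked bumpless pipedreams of size $n$ and the set of reverse compatible pairs, which preserve weights and associated permutations, i.e. $\mathrm{wt}(\Phi(D))=\mathrm{wt}(D)$ and $w(\Phi(D))=w(D)$ for all $D\in\mathrm{MBPD}(n)$ (and likewise for $\Psi$). Furthermore, these bijections restrict to mutually inverse bijections between the set of reduced, unmarked bumpless pipedreams in $\mathrm{MBPD}(n)$ and the set of reduced reverse compatible pairs in $\mathrm{RCP}(n)$.
   Context: Fix $n\ge1$ and write $[n]=\{1,\dots,n\}$. **Tiles.** There are seven tiles, each a unit square determined by which of its sides its centre is connected to: $\mathsf B$ (blank: no side), $\mathsf H$ (left, right), $\mathsf V$ (top, bottom), $\mathsf P$ (plus: all four sides, a horizontal line crossing a vertical line), $\mathsf R$ (right, bottom), $\mathsf J$ (top, left), and $\mathsf J^\bullet$ (marked J: same connections as $\mathsf J$, but carrying a mark). A tile is heavy if it is $\mathsf B$ or $\mathsf J^\bullet$. **Marked bumpless pipedreams.** $\mathrm{MBPD}(n)$ is the set of $n\times n$ matrices $D=(D_{i,j})$ of tiles (rows numbered top to bottom, columns left to right) such that: $D_{i,j}$ connects right iff $D_{i,j+1}$ connects left; $D_{i,j}$ connects to the bottom iff $D_{i+1,j}$ connects to the top; every tile in column $n$ connects right; every tile in row $n$ connects to the bottom; no tile in row $1$ connects to the top; no tile in column $1$ connects left. So there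 are $n$ pipes; pipe $i$ enters through the right edge of row $i$ and travels left and down until it exits through the bottom edge. The associated permutation $w(D)\in S_n$: read the $\mathsf P$ tiles row by row from top to bottom, and from right to left within each row. At each $\mathsf P$ tile, if the two pipes arriving there have already crossed at an earlier tile, the tile is treated as a bump (the pipe arriving from the right leaves through the bottom, the pipe arriving from the top leaves through the left); otherwise the two pipes go straight and cross. Then $w(D)(i)$ is the column through whose bottom edge pipe $i$ exits. The weight of $D$ is $\mathrm{wt}(D)=(m_1,\dots,m_n)$, where $m_i$ is the number of heavy tiles in row $i$. $D$ is unmarked if it has no $\mathsf J^\bullet$, and reduced if no two pipes (all going straight at $\mathsf P$ tiles) meet in more than one $\mathsf P$ tile. **Reverse compatible pairs.** A biletter is a pair of integers $(i,a)$ with $1\le i\le a<n$. Order biletters by $(i_1,a_1)>(i_2,a_2)$ if $i_1>i_2$, or $i_1=i_2$ and $a_1<a_2$. $\mathrm{RCP}(n)$ is the set of finite (possibly empty) sequences $B=((i_1,a_1),\dots,(i_\ell,a_\ell))$ of biletters that are strictly decreasing in this order. The weight is $\mathrm{wt}(B)=(m_1,\dots,m_n)$, where $m_i$ is the number of biletters of $B$ with first entry $i$. The associated permutation is $w(B)=s_{a_\ell}*s_{a_{\ell-1}}*\cdots*s_{a_1}\in S_n$, where $s_a=(a\ a{+}1)$ and $*$ is the Demazure ($0$-Hecke) product: the monoid structure on $S_n$ with $s_i*w=s_iw$ if $\ell(s_iw)>\ell(w)$ and $s_i*w=w$ otherwise. $B$ is reduced if its number of biletters equals the Coxeter length of $w(B)$.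 *)

theory Defs
  imports "HOL-Library.FuncSet" "HOL-Combinatorics.Combinatorics"
begin

section \<open>Marked bumpless pipedreams\<close>

datatype tile = Blank | Horiz | Vert | Plus | RTile | JTile | MarkedJ

fun conn_left :: "tile \<Rightarrow> bool" where
  "conn_left t \<longleftrightarrow> t \<in> {Horiz, Plus, JTile, MarkedJ}"

fun conn_right :: "tile \<Rightarrow> bool" where
  "conn_right t \<longleftrightarrow> t \<in> {Horiz, Plus, RTile}"

fun conn_top :: "tile \<Rightarrow> bool" where
  "conn_top t \<longleftrightarrow> t \<in> {Vert, Plus, JTile, MarkedJ}"

fun conn_bottom :: "tile \<Rightarrow> bool" where
  "conn_bottom t \<longleftrightarrow> t \<in> {Vert, Plus, RTile}"

definition heavy :: "tile \<Rightarrow> bool" where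
  "heavy t \<longleftrightarrow> t = Blank \<or> t = MarkedJ"

text \<open>A matrix of tiles is a function on pairs (row, column), both indices running from 1 to
  n; it is \<^const>\<open>undefined\<close> elsewhere, so that equality is equality of matrices.\<close>

type_synonym tile_matrix = "nat \<times> nat \<Rightarrow> tile"

definition MBPD :: "nat \<Rightarrow> tile_matrix set" where
  "MBPD n = {D \<in> {1..n} \<times> {1..n} \<rightarrow>\<^sub>E UNIV.
     (\<forall>i\<in>{1..n}. \<forall>j\<in>{1..<n}. conn_right (D (i, j)) \<longleftrightarrow> conn_left (D (i, Suc j))) \<and>
     (\<forall>i\<in>{1..<n}. \<forall>j\<in>{1..n}. conn_bottom (D (i, j)) \<longleftrightarrow> conn_top (D (Suc i, j))) \<and>
     (\<forall>i\<in>{1..n}. conn_right (D (i, n))) \<and>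
     (\<forall>j\<in>{1..n}. conn_bottom (D (n, j))) \<and>
     (\<forall>j\<in>{1..n}. \<not> conn_top (D (1, j))) \<and>
     (\<forall>i\<in>{1..n}. \<not> conn_left (D (i, 1)))}"

definition wt_MBPD :: "nat \<Rightarrow> tile_matrix \<Rightarrow> nat list" where
  "wt_MBPD n D = map (\<lambda>i. card {j \<in> {1..n}. heavy (D (i, j))}) [1..<Suc n]"

definition unmarked :: "nat \<Rightarrow> tile_matrix \<Rightarrow> bool" where
  "unmarked n D \<longleftrightarrow> (\<forall>i\<in>{1..n}. \<forall>j\<in>{1..n}. D (i, j) \<noteq> MarkedJ)"

text \<open>The pipes are followed by visiting all cells in reading order (rows from top to bottom,
  right to left within a row). The state is a triple \<open>(h, v, X)\<close>: when cell \<open>(i, j)\<close> is reached,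
  \<open>h i\<close> is the pipe on its right edge and \<open>v j\<close> the pipe on its top edge (these values are
  meaningless if no pipe is there), and \<open>X\<close> lists, as unordered pairs, the pipes that have crossed
  at the \<^const>\<open>Plus\<close> tiles visited so far, one entry per crossing. Pipe \<open>i\<close> enters at the right
  edge of row \<open>i\<close>, so initially \<open>h\<close> is the identity. The flag \<open>bump\<close> says whether a
  \<^const>\<open>Plus\<close> tile where two pipes meet again is treated as a bump; without it, pipes always
  go straight.\<close>

type_synonym pipe_state = "(nat \<Rightarrow> nat) \<times> (nat \<Rightarrow> nat) \<times> nat set list"

fun pipe_step :: "bool \<Rightarrow> tile_matrix \<Rightarrow> nat \<times> nat \<Rightarrow> pipe_state \<Rightarrow> pipe_state" where
  "pipe_step bump D (i, j) (h, v, X) =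
     (case D (i, j) of
        Blank \<Rightarrow> (h, v, X)
      | Horiz \<Rightarrow> (h, v, X)
      | Vert \<Rightarrow> (h, v, X)
      | RTile \<Rightarrow> (h, v(j := h i), X)
      | JTile \<Rightarrow> (h(i := v j), v, X)
      | MarkedJ \<Rightarrow> (h(i := v j), v, X)
      | Plus \<Rightarrow>
          if bump \<and> {h i, v j} \<in> set X then (h(i := v j), v(j := h i), X)
          else (h, v, X @ [{h i, v j}]))"

definition reading_order :: "nat \<Rightarrow> (nat \<times> nat) list" where
  "reading_order n = concat (map (\<lambda>i. map (\<lambda>j. (i, j)) (rev [1..<Suc n])) [1..<Suc n])"

definition pipe_trace :: "bool \<Rightarrow> nat \<Rightarrow> tile_matrix \<Rightarrow> pipe_state" where
  "pipe_trace bump n D = fold (pipe_step bump D) (reading_order n) (\<lambda>i. i, \<lambda>_. 0, [])"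

definition exit_pipe :: "nat \<Rightarrow> tile_matrix \<Rightarrow> nat \<Rightarrow> nat" where
  "exit_pipe n D j = fst (snd (pipe_trace True n D)) j"

text \<open>Permutations of \<open>{1..n}\<close> are functions on all of \<open>nat\<close> fixing everything outside
  \<open>{1..n}\<close>, as in \<^const>\<open>permutes\<close>.\<close>

definition perm_MBPD :: "nat \<Rightarrow> tile_matrix \<Rightarrow> nat \<Rightarrow> nat" where
  "perm_MBPD n D i = (if i \<in> {1..n} then THE j. j \<in> {1..n} \<and> exit_pipe n D j = i else i)"

definition straight_meetings :: "nat \<Rightarrow> tile_matrix \<Rightarrow> nat set list" where
  "straight_meetings n D = snd (snd (pipe_trace False n D))"

definition reduced_MBPD :: "nat \<Rightarrow> tile_matrix \<Rightarrow> bool" where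
  "reduced_MBPD n D \<longleftrightarrow>
     (\<forall>p\<in>{1..n}. \<forall>q\<in>{1..n}. p \<noteq> q \<longrightarrow> count_list (straight_meetings n D) {p, q} \<le> 1)"

section \<open>The Demazure product\<close>

abbreviation simple_refl :: "nat \<Rightarrow> nat \<Rightarrow> nat" where
  "simple_refl a \<equiv> transpose a (Suc a)"

definition coxeter_length :: "nat \<Rightarrow> (nat \<Rightarrow> nat) \<Rightarrow> nat" where
  "coxeter_length n w =
     (LEAST k. \<exists>as. length as = k \<and> set as \<subseteq> {1..<n} \<and>
        w = foldr (\<lambda>a u. simple_refl a \<circ> u) as id)"

text \<open>Only Demazure products \<open>s\<^sub>a * w\<close> with a simple reflection as left factor are needed, because
  a product of simple reflections can be bracketed to the right.\<close>

definition demazure :: "nat \<Rightarrow> nat \<Rightarrow> (nat \<Rightarrow> nat) \<Rightarrow> (nat \<Rightarrow> nat)" where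
  "demazure n a w =
     (if coxeter_length n (simple_refl a \<circ> w) > coxeter_length n w
      then simple_refl a \<circ> w else w)"

section \<open>Reverse compatible pairs\<close>

type_synonym biletter = "nat \<times> nat"

definition biletters :: "nat \<Rightarrow> biletter set" where
  "biletters n = {(i, a). 1 \<le> i \<and> i \<le> a \<and> a < n}"

fun biletter_greater :: "biletter \<Rightarrow> biletter \<Rightarrow> bool" where
  "biletter_greater (i1, a1) (i2, a2) \<longleftrightarrow> i1 > i2 \<or> (i1 = i2 \<and> a1 < a2)"

definition RCP :: "nat \<Rightarrow> biletter list set" where
  "RCP n = {B. set B \<subseteq> biletters n \<and> sorted_wrt biletter_greater B}"

definition wt_RCP :: "nat \<Rightarrow> biletter list \<Rightarrow> nat list" where
  "wt_RCP n B = map (\<lambda>i. length (filter (\<lambda>b. fst b = i) B)) [1..<Suc n]"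

text \<open>\<^const>\<open>fold\<close> applies the first biletter first, so the last one is the outermost left factor.\<close>

definition perm_RCP :: "nat \<Rightarrow> biletter list \<Rightarrow> nat \<Rightarrow> nat" where
  "perm_RCP n B = fold (\<lambda>(i, a) w. demazure n a w) B id"

definition reduced_RCP :: "nat \<Rightarrow> biletter list \<Rightarrow> bool" where
  "reduced_RCP n B \<longleftrightarrow> length B = coxeter_length n (perm_RCP n B)"

end

theory Submission
  imports Defs "HOL-Library.Poly_Mapping"
begin

text \<open>
  The bijections come from an equality of generating functions: for every permutation \<open>w\<close>, the sum of
  the monomials \<open>x\<^sup>w\<^sup>t\<close> over the marked bumpless pipedreams of \<open>w\<close> equals the sum over the reverse
  compatible pairs of \<open>w\<close>.

  At a \<^const>\<open>Plus\<close> tile the rule ``cross unless already crossed'' always sends the smaller label down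
  and the larger label to the left, so pipedreams are the states of a coloured vertex model with local
  weights, which satisfies a Yang--Baxter equation. Row \<open>n\<close> contains no heavy tile, so its
  parameter may be set to 0. The Yang--Baxter equation moves this row with parameter 0 up to row 1;
  passing the row with parameter \<open>x\<^sub>i\<close> contributes the 0-Hecke factor \<open>1 + x\<^sub>i u\<^sub>i\<close> acting on the
  labels. A first row without heavy tiles forces its pipe straight to column 1 and down, which leaves
  a model of size \<open>n - 1\<close> with parameters \<open>x\<^sub>1, \<dots>, x\<^sub>n\<^sub>-\<^sub>1\<close> in rows \<open>2, \<dots>, n\<close>. The
  generating function of the reverse compatible pairs is the product of the factors
  \<open>1 + x\<^sub>i u\<^sub>a\<close>; collecting those with \<open>a = i\<close> yields the same recursion.

  Reducedness needs no separate bijection: on both sides the reduced (and unmarked) objects are those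
  whose total weight is the Coxeter length of their permutation, because a pipedream has as many blank
  as \<^const>\<open>Plus\<close> tiles.
\<close>

section \<open>The Yang--Baxter equation of the vertex model\<close>

text \<open>The label 0 stands for an edge without pipe. Given the labels \<open>t\<close> and \<open>r\<close> on the top and right edges
  of a cell, \<open>vertex x t r k\<close> sums the weight times \<open>k l b\<close> over all tiles, where \<open>l\<close> and \<open>b\<close> are the
  resulting left and bottom labels. The factor \<open>1 + x\<close> accounts for a J tile with or without mark.\<close>

definition vertex :: "'a::comm_semiring_1 \<Rightarrow> nat \<Rightarrow> nat \<Rightarrow> (nat \<Rightarrow> nat \<Rightarrow> 'a) \<Rightarrow> 'a" where
  "vertex x t r k =
     (if t = 0 then if r = 0 then x * k 0 0 else k r 0 + k 0 r
      else if r = 0 then k 0 t + (1 + x) * k t 0 else k (max t r) (min t r))"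

text \<open>The R-matrix, specialised to a second row of parameter 0. On two pipes it is \<open>1 + x u\<close> with \<open>u\<close> the
  0-Hecke generator; the other entries are what the Yang--Baxter equation forces.\<close>

definition exch :: "'a::comm_semiring_1 \<Rightarrow> nat \<Rightarrow> nat \<Rightarrow> (nat \<Rightarrow> nat \<Rightarrow> 'a) \<Rightarrow> 'a" where
  "exch x p q k =
     (if p = 0 then if q = 0 then k 0 0 else (1 + x) * k 0 q + x * k q 0
      else if q = 0 then k p 0 else if p < q then k p q + x * k q p else (1 + x) * k p q)"

text \<open>A finite check: the incoming labels \<open>t\<close>, \<open>r\<close>,
  \<open>r'\<close> are split by which of them are 0 and by their relative order, and each case is a
  polynomial identity in \<open>x\<close>. The R-matrix moves from the left edges to the right edges
  while the two rows trade the parameters \<open>x\<close> and 0.\<close>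

lemma yang_baxter:
  "vertex x t r (\<lambda>l b. vertex 0 b r' (\<lambda>l' b'. exch x l l' (\<lambda>p q. k p q b'))) =
   exch x r r' (\<lambda>p q. vertex 0 t p (\<lambda>l b. vertex x b q (\<lambda>l' b'. k l l' b')))"
  by (simp add: vertex_def exch_def algebra_simps max_def min_def)

text \<open>In the following operators, \<open>g h v\<close> is an observable of the labels \<open>h i\<close> on the current horizontal
  edge of row \<open>i\<close> and \<open>v j\<close> on the current vertical edge of column \<open>j\<close>. Operators act on observables,
  so the outermost one is the cell visited first.\<close>

definition cell ::
  "nat \<Rightarrow> nat \<Rightarrow> 'a::comm_semiring_1 \<Rightarrow> ((nat \<Rightarrow> nat) \<Rightarrow> (nat \<Rightarrow> nat) \<Rightarrow> 'a) \<Rightarrow> (nat \<Rightarrow> nat) \<Rightarrow> (nat \<Rightarrow> nat) \<Rightarrow> 'a"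
  where "cell i j x g h v = vertex x (v j) (h i) (\<lambda>l b. g (h(i := l)) (v(j := b)))"

definition cross ::
  "nat \<Rightarrow> nat \<Rightarrow> 'a::comm_semiring_1 \<Rightarrow> ((nat \<Rightarrow> nat) \<Rightarrow> (nat \<Rightarrow> nat) \<Rightarrow> 'a) \<Rightarrow> (nat \<Rightarrow> nat) \<Rightarrow> (nat \<Rightarrow> nat) \<Rightarrow> 'a"
  where "cross i i' x g h v = exch x (h i) (h i') (\<lambda>p q. g (h(i := p, i' := q)) v)"

lemma cell_yang_baxter:
  assumes "i \<noteq> i'"
  shows "cell i j x (cell i' j 0 (cross i i' x g)) = cross i i' x (cell i j 0 (cell i' j x g))"
proof (intro ext)
  fix h v :: "nat \<Rightarrow> nat"
  have *: "h(i := l, i' := l', i := p, i' := q) = h(i := p, i' := q)"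
    "h(i := l, i' := l', i := p) = h(i := p, i' := l')" for l l' p q
    using assms by auto
  show "cell i j x (cell i' j 0 (cross i i' x g)) h v =
      cross i i' x (cell i j 0 (cell i' j x g)) h v"
    using assms yang_baxter[of x "v j" "h i" "h i'" "\<lambda>p q b. g (h(i := p, i' := q)) (v(j := b))"]
    unfolding cell_def cross_def by (simp add: *)
qed

lemma vertex_commute:
  "vertex x t r (\<lambda>l b. vertex y t' r' (k l b)) = vertex y t' r' (\<lambda>l' b'. vertex x t r (\<lambda>l b. k l b l' b'))"
  by (simp add: vertex_def algebra_simps)

lemma cell_commute:
  assumes "i \<noteq> i'" "j \<noteq> j'"
  shows "cell i j x (cell i' j' y g) = cell i' j' y (cell i j x g)"
proof (intro ext)
  fix h v :: "nat \<Rightarrow> nat"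
  show "cell i j x (cell i' j' y g) h v = cell i' j' y (cell i j x g) h v"
    using assms unfolding cell_def
    by (simp add: fun_upd_twist[of i i'] fun_upd_twist[of j j'])
      (rule vertex_commute)
qed

lemma cross_cell_commute:
  assumes "i \<noteq> r" "i' \<noteq> r"
  shows "cross i i' x (cell r j y g) = cell r j y (cross i i' x g)"
proof (intro ext)
  fix h v :: "nat \<Rightarrow> nat"
  have *: "exch x p q (\<lambda>l b. vertex y t' r' (k l b)) = vertex y t' r' (\<lambda>l' b'. exch x p q (\<lambda>l b. k l b l' b'))"
    for p q t' r' and k :: "nat \<Rightarrow> nat \<Rightarrow> nat \<Rightarrow> nat \<Rightarrow> 'a"
    by (simp add: vertex_def exch_def algebra_simps)
  have **: "h(i := p, i' := q, r := l) = h(r := l, i := p, i' := q)" for p q l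
    using assms by auto
  show "cross i i' x (cell r j y g) h v = cell r j y (cross i i' x g) h v"
    using assms unfolding cell_def cross_def by (simp add: * **)
qed

definition row where
  "row i x js g = foldr (\<lambda>j. cell i j x) js g"

lemma row_simps [simp]:
  "row i x [] g = g" "row i x (j # js) g = cell i j x (row i x js g)"
  by (simp_all add: row_def)

lemma row_append: "row i x (js @ js') g = row i x js (row i x js' g)"
  by (simp add: row_def)

lemma row_cell_commute:
  assumes "i \<noteq> i'" "j \<notin> set js"
  shows "row i x js (cell i' j y g) = cell i' j y (row i x js g)"
  using assms by (induction js) (auto simp: cell_commute[of i i'])

lemma cross_row_commute:
  assumes "i \<noteq> r" "i' \<noteq> r"
  shows "cross i i' x (row r y js g) = row r y js (cross i i' x g)"
  using assms by (induction js) (auto simp: cross_cell_commute)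

text \<open>Train argument: cells in different rows and columns commute, so the two rows can be
  regrouped column by column, and the R-matrix passes through one column at a time.\<close>

lemma row_yang_baxter:
  assumes "i \<noteq> i'" "distinct js"
  shows "row i x js (row i' 0 js (cross i i' x g)) = cross i i' x (row i 0 js (row i' x js g))"
  using assms(2)
proof (induction js)
  case (Cons j js)
  have "row i x (j # js) (row i' 0 (j # js) (cross i i' x g)) =
      cell i j x (cell i' j 0 (row i x js (row i' 0 js (cross i i' x g))))"
    using Cons.prems assms(1) by (simp add: row_cell_commute)
  also have "\<dots> = cross i i' x (cell i j 0 (cell i' j x (row i 0 js (row i' x js g))))"
    using Cons by (simp add: cell_yang_baxter[OF assms(1)])
  also have "\<dots> = cross i i' x (row i 0 (j # js) (row i' x (j # js) g))"
    using Cons.prems assms(1) by (simp add: row_cell_commute)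
  finally show ?case .
qed simp

section \<open>Moving a row of parameter zero to the top\<close>

text \<open>Border conditions are expressed through the support of the observable:
  \<open>h_closed\<close> demands an empty left border in row \<open>i\<close>,
  \<open>v_full\<close> a pipe at the bottom of column \<open>j\<close>.\<close>

definition h_closed :: "((nat \<Rightarrow> nat) \<Rightarrow> (nat \<Rightarrow> nat) \<Rightarrow> 'a::zero) \<Rightarrow> nat \<Rightarrow> bool" where
  "h_closed g i \<longleftrightarrow> (\<forall>h v. h i \<noteq> 0 \<longrightarrow> g h v = 0)"

definition v_full :: "((nat \<Rightarrow> nat) \<Rightarrow> (nat \<Rightarrow> nat) \<Rightarrow> 'a::zero) \<Rightarrow> nat \<Rightarrow> bool" where
  "v_full g j \<longleftrightarrow> (\<forall>h v. v j = 0 \<longrightarrow> g h v = 0)"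

lemma h_closed_cell: "h_closed g i \<Longrightarrow> i \<noteq> r \<Longrightarrow> h_closed (cell r j x g) i"
  by (auto simp: h_closed_def cell_def vertex_def)

lemma h_closed_row: "h_closed g i \<Longrightarrow> i \<noteq> r \<Longrightarrow> h_closed (row r x js g) i"
  by (induction js) (auto simp: h_closed_cell)

lemma h_closed_rows:
  "h_closed g i \<Longrightarrow> i \<notin> r ` set is \<Longrightarrow> h_closed (foldr (\<lambda>k. row (r k) (x k) js) is g) i"
  by (induction "is") (auto simp: h_closed_row)

lemma v_full_cell: "v_full g j \<Longrightarrow> j \<noteq> c \<Longrightarrow> v_full (cell i c x g) j"
  by (auto simp: v_full_def cell_def vertex_def)

lemma v_full_row: "v_full g j \<Longrightarrow> j \<notin> set js \<Longrightarrow> v_full (row i x js g) j"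
  by (induction js) (auto simp: v_full_cell)

text \<open>\<open>exch\<close> never turns a nonempty pair of edges into two empty ones, so both
  sides vanish unless both labels are 0, and there \<open>exch\<close> is the identity.\<close>

lemma cross_closed:
  assumes "h_closed g i" "h_closed g i'" "i \<noteq> i'"
  shows "cross i i' x g = g"
proof (intro ext)
  fix h v :: "nat \<Rightarrow> nat"
  have "g h' v = 0" if "h' i \<noteq> 0 \<or> h' i' \<noteq> 0" for h'
    using assms that unfolding h_closed_def by auto
  moreover have "h(i := 0, i' := 0) = h" if "h i = 0" "h i' = 0"
    using that by auto
  ultimately show "cross i i' x g h v = g h v"
    using assms(3) by (auto simp: cross_def exch_def)
qed

text \<open>In \<open>vertex\<close> the parameter only occurs with bottom label 0 (blank tile,
  marked J), and these terms are killed by a full bottom border. This is why the last row may be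
  given parameter 0.\<close>

lemma row_full:
  assumes "distinct js" "\<And>j. j \<in> set js \<Longrightarrow> v_full g j"
  shows "row i x js g = row i 0 js g"
  using assms
proof (induction js)
  case (Cons j js)
  have "v_full (row i 0 js g) j"
    using Cons.prems by (intro v_full_row) auto
  then have "cell i j x (row i 0 js g) = cell i j 0 (row i 0 js g)"
    by (intro ext) (auto simp: v_full_def cell_def vertex_def)
  then show ?case using Cons by simp
qed simp

text \<open>An R-matrix is created for free at the empty left border; it runs through the two lowest
  rows, exchanges their parameters and comes out on the right as the outermost operator. Row
  positions stay fixed, so parameter \<open>x i\<close> ends up in row \<open>Suc i\<close>.\<close>

lemma rows_move_zero:
  assumes "a \<le> b" "distinct js" "\<And>i. a \<le> i \<Longrightarrow> i \<le> b \<Longrightarrow> h_closed g i"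
  shows "foldr (\<lambda>i. row i (x i) js) [a..<b] (row b 0 js g) =
    foldr (\<lambda>i. cross i (Suc i) (x i)) (rev [a..<b])
      (row a 0 js (foldr (\<lambda>i. row (Suc i) (x i) js) [a..<b] g))"
  using assms
proof (induction b arbitrary: g rule: dec_induct)
  case base
  show ?case by simp
next
  case (step b)
  have comm: "foldr (\<lambda>i. row i (x i) js) is (cross b (Suc b) y F) =
      cross b (Suc b) y (foldr (\<lambda>i. row i (x i) js) is F)"
    if "\<forall>i\<in>set is. i < b" for "is" y F
    using that by (induction "is") (auto simp: cross_row_commute)
  have g: "cross b (Suc b) (x b) g = g"
    using step by (intro cross_closed) auto
  have "foldr (\<lambda>i. row i (x i) js) [a..<Suc b] (row (Suc b) 0 js g) =
      foldr (\<lambda>i. row i (x i) js) [a..<b] (row b (x b) js (row (Suc b) 0 js (cross b (Suc b) (x b) g)))"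
    using step.hyps by (simp add: g)
  also have "\<dots> = cross b (Suc b) (x b)
      (foldr (\<lambda>i. row i (x i) js) [a..<b] (row b 0 js (row (Suc b) (x b) js g)))"
    using step.prems by (simp add: row_yang_baxter comm)
  also have "\<dots> = cross b (Suc b) (x b) (foldr (\<lambda>i. cross i (Suc i) (x i)) (rev [a..<b])
      (row a 0 js (foldr (\<lambda>i. row (Suc i) (x i) js) [a..<b] (row (Suc b) (x b) js g))))"
    using step.prems by (subst step.IH) (auto intro: h_closed_row)
  also have "\<dots> = foldr (\<lambda>i. cross i (Suc i) (x i)) (rev [a..<Suc b])
      (row a 0 js (foldr (\<lambda>i. row (Suc i) (x i) js) [a..<Suc b] g))"
    using step.hyps by simp
  finally show ?case .
qed

section \<open>Forced pipes: a first row of parameter zero and an occupied leftmost column\<close>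

lemma row_zero_dead:
  assumes "h a = 0" "js \<noteq> []" "v (hd js) = 0"
  shows "row a 0 js g h v = 0"
  using assms by (cases js) (auto simp: cell_def vertex_def)

text \<open>If the pipe turned down before the last visited column \<open>c\<close>, the next cell
  would have empty top and right edges, hence a blank tile of weight 0. At \<open>c\<close> it
  cannot leave to the left because of \<open>h_closed\<close>, so it goes down there.\<close>

lemma row_zero_straight:
  assumes "h a \<noteq> 0" "\<And>j. j \<in> set (js @ [c]) \<Longrightarrow> v j = 0" "distinct (js @ [c])" "h_closed g a"
  shows "row a 0 (js @ [c]) g h v = g (h(a := 0)) (v(c := h a))"
  using assms
proof (induction js)
  case Nil
  then have "g h (v(c := 0)) = 0"
    unfolding h_closed_def by blast
  then show ?case using Nil by (simp add: cell_def vertex_def del: fun_upd_apply)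
next
  case (Cons j js)
  have "row a 0 (js @ [c]) g (h(a := 0)) (v(j := h a)) = 0"
    using Cons.prems by (intro row_zero_dead) (cases js; auto)+
  moreover have "v(j := 0) = v"
    using Cons.prems by auto
  moreover have "row a 0 (js @ [c]) g h v = g (h(a := 0)) (v(c := h a))"
    using Cons.prems by (intro Cons.IH) auto
  ultimately show ?case using Cons.prems by (simp add: cell_def[of a j] vertex_def del: fun_upd_apply)
qed

lemma row_cong_nonempty:
  assumes "\<And>h v. v c \<noteq> 0 \<Longrightarrow> f h v = g h v" "c \<notin> set js" "v c \<noteq> 0"
  shows "row i x js f h v = row i x js g h v"
  using assms(2,3) by (induction js arbitrary: h v) (auto simp: assms(1) cell_def vertex_def)

text \<open>A J or plus tile in column \<open>c\<close> would send a pipe through the empty left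
  border, so the pipe already in that column passes the row vertically, with weight 1.\<close>

lemma row_full_column:
  assumes "h_closed g i" "c \<notin> set js" "v c \<noteq> 0"
  shows "row i x (js @ [c]) g h v = row i x js g h v"
  unfolding row_append
proof (rule row_cong_nonempty[of c])
  fix h v :: "nat \<Rightarrow> nat"
  assume v: "v c \<noteq> 0"
  have "h(i := 0) = h" if "h i = 0"
    using that by auto
  with v assms(1) show "row i x [c] g h v = g h v"
    by (auto simp: cell_def vertex_def h_closed_def)
qed (use assms in auto)

lemma rows_full_column:
  assumes "\<And>i. i \<in> set is \<Longrightarrow> h_closed g (r i)" "distinct (map r is)" "c \<notin> set js" "v c \<noteq> 0"
  shows "foldr (\<lambda>i. row (r i) (x i) (js @ [c])) is g h v = foldr (\<lambda>i. row (r i) (x i) js) is g h v"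
  using assms
proof (induction "is" arbitrary: h v)
  case (Cons i "is")
  have "h_closed (foldr (\<lambda>i. row (r i) (x i) (js @ [c])) is g) (r i)"
    using Cons.prems by (intro h_closed_rows) auto
  then have "foldr (\<lambda>i. row (r i) (x i) (js @ [c])) (i # is) g h v =
      row (r i) (x i) js (foldr (\<lambda>i. row (r i) (x i) (js @ [c])) is g) h v"
    using Cons.prems by (simp add: row_full_column del: row_append)
  also have "\<dots> = row (r i) (x i) js (foldr (\<lambda>i. row (r i) (x i) js) is g) h v"
    using Cons by (intro row_cong_nonempty[of c]) auto
  finally show ?case by simp
qed simp

section \<open>The 0-Hecke factors \<open>1 + x u_a\<close> acting on words of labels\<close>

definition letter :: "nat \<Rightarrow> 'a::comm_semiring_1 \<Rightarrow> ((nat \<Rightarrow> nat) \<Rightarrow> 'a) \<Rightarrow> (nat \<Rightarrow> nat) \<Rightarrow> 'a" where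
  "letter a x f u = exch x (u a) (u (Suc a)) (\<lambda>p q. f (u(a := p, Suc a := q)))"

text \<open>\<open>cross\<close> ignores the vertical labels, so a chain of crossings acts on the
  word \<open>h\<close> of right labels alone.\<close>

lemma crosses_eq_letters:
  "foldr (\<lambda>i. cross i (Suc i) (x i)) is g h v = foldr (\<lambda>i. letter i (x i)) is (\<lambda>h. g h v) h"
  by (induction "is" arbitrary: h) (auto simp: cross_def letter_def)

lemma letter_commute:
  assumes "Suc a < b"
  shows "letter a x (letter b y f) = letter b y (letter a x f)"
proof
  fix u
  have *: "exch x p q (\<lambda>l b. exch y t' r' (k l b)) = exch y t' r' (\<lambda>l' b'. exch x p q (\<lambda>l b. k l b l' b'))"
    for p q t' r' and k :: "nat \<Rightarrow> nat \<Rightarrow> nat \<Rightarrow> nat \<Rightarrow> 'a"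
    by (simp add: exch_def algebra_simps)
  have "u(a := p, Suc a := q, b := p', Suc b := q') = u(b := p', Suc b := q', a := p, Suc a := q)"
    for p q p' q' :: nat
    using assms by auto
  then show "letter a x (letter b y f) u = letter b y (letter a x f) u"
    using assms unfolding letter_def by (simp add: *)
qed

lemma letter_commute_letters:
  assumes "\<And>b. b \<in> set bs \<Longrightarrow> Suc a < b"
  shows "foldr (\<lambda>b. letter b (y b)) bs (letter a x f) = letter a x (foldr (\<lambda>b. letter b (y b)) bs f)"
  using assms by (induction bs) (auto simp: letter_commute)

lemma letters_fun_upd:
  assumes "\<And>b. b \<in> set bs \<Longrightarrow> snd b \<noteq> c \<and> Suc (snd b) \<noteq> c"
  shows "foldr (\<lambda>(i, a). letter a (x i)) bs F (h(c := d)) =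
         foldr (\<lambda>(i, a). letter a (x i)) bs (\<lambda>u. F (u(c := d))) h"
  using assms
proof (induction bs arbitrary: h)
  case (Cons b bs)
  obtain i a where b: "b = (i, a)" by force
  have "a \<noteq> c" "Suc a \<noteq> c" using Cons.prems[of b] b by auto
  moreover from this have "(h(c := d)) a = h a" "(h(c := d)) (Suc a) = h (Suc a)"
    by auto
  moreover from \<open>a \<noteq> c\<close> \<open>Suc a \<noteq> c\<close> have "h(c := d, a := p, Suc a := q) = (h(a := p, Suc a := q))(c := d)" for p q
    by auto
  ultimately show ?case using Cons by (simp add: b letter_def del: fun_upd_apply)
qed simp

lemma letter_cong:
  assumes "\<And>p q. {p, q} = {u a, u (Suc a)} \<Longrightarrow> f (u(a := p, Suc a := q)) = g (u(a := p, Suc a := q))"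
    and "u a \<noteq> 0" "u (Suc a) \<noteq> 0"
  shows "letter a x f u = letter a x g u"
  using assms(2,3) assms(1)[of "u a" "u (Suc a)"] assms(1)[of "u (Suc a)" "u a"]
  by (auto simp: letter_def exch_def insert_commute simp del: fun_upd_apply)

text \<open>On nonzero labels a letter keeps or swaps two entries. Hence words reached from
  \<open>u\<close> stay nonzero on \<open>S\<close> and unchanged outside it, and only such words
  matter for \<open>f\<close> and \<open>g\<close>.\<close>

lemma letters_cong_nonzero:
  assumes "\<And>u. \<forall>i\<in>S. u i \<noteq> 0 \<Longrightarrow> \<forall>i. i \<notin> S \<longrightarrow> u i = h i \<Longrightarrow> f u = g u"
    and "\<And>i. i \<in> set is \<Longrightarrow> i \<in> S \<and> Suc i \<in> S"
    and "\<forall>i\<in>S. u i \<noteq> 0" "\<forall>i. i \<notin> S \<longrightarrow> u i = h i"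
  shows "foldr (\<lambda>i. letter i (x i)) is f u = foldr (\<lambda>i. letter i (x i)) is g u"
  using assms(2-4)
proof (induction "is" arbitrary: u)
  case (Cons i "is")
  have i: "i \<in> S" "Suc i \<in> S"
    using Cons.prems(1) by auto
  have "foldr (\<lambda>i. letter i (x i)) is f (u(i := p, Suc i := q)) =
      foldr (\<lambda>i. letter i (x i)) is g (u(i := p, Suc i := q))" if "{p, q} = {u i, u (Suc i)}" for p q
  proof (intro Cons.IH)
    have "p \<noteq> 0" "q \<noteq> 0"
      using that i Cons.prems(2) by (metis insertI1 insertI2 insertE singletonD)+
    then show "\<forall>j\<in>S. (u(i := p, Suc i := q)) j \<noteq> 0"
      using Cons.prems(2) by auto
  qed (use Cons.prems i in auto)
  then show ?case
    using Cons.prems(2) i by (simp del: fun_upd_apply) (rule letter_cong, auto)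
qed (use assms(1) in auto)

text \<open>The offset \<open>m\<close> is the number of rows and columns already removed in the recursion.\<close>

definition biletter_seq :: "nat \<Rightarrow> nat \<Rightarrow> biletter list" where
  "biletter_seq n m = concat (map (\<lambda>i. map (Pair i) [i..<n]) (rev [Suc m..<n]))"

definition words_gf ::
  "nat \<Rightarrow> nat \<Rightarrow> (nat \<Rightarrow> 'a::comm_semiring_1) \<Rightarrow> ((nat \<Rightarrow> nat) \<Rightarrow> 'a) \<Rightarrow> (nat \<Rightarrow> nat) \<Rightarrow> 'a" where
  "words_gf n m x f = foldr (\<lambda>(i, a). letter a (x i)) (biletter_seq n m) f"

lemma foldr_map_Pair: "foldr (\<lambda>(i, a). F i a) (map (Pair i) as) = foldr (F i) as"
  by (induction as) auto

lemma words_gf_altdef: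
  "words_gf n m x f = foldr (\<lambda>i. foldr (\<lambda>a. letter a (x i)) [i..<n]) (rev [Suc m..<n]) f"
proof -
  have "foldr (\<lambda>(i, a). letter a (x i)) (concat (map (\<lambda>i. map (Pair i) [i..<n]) is)) f =
      foldr (\<lambda>i. foldr (\<lambda>a. letter a (x i)) [i..<n]) is f" for "is"
    by (induction "is") (simp_all add: foldr_map_Pair)
  then show ?thesis by (simp add: words_gf_def biletter_seq_def)
qed

text \<open>The letter with index \<open>i\<close> has to pass the blocks of larger indices
  \<open>j > i\<close>. With their first letters already removed, these contain only indices
  \<open>b > j\<close>, so \<open>b\<close> is at least \<open>i + 2\<close> and the letters
  commute.\<close>

lemma letters_extract_first:
  assumes "a \<le> n"
  shows "foldr (\<lambda>i. foldr (\<lambda>b. letter b (x i)) [i..<n]) (rev [a..<n]) f =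
    foldr (\<lambda>i. letter i (x i)) (rev [a..<n])
      (foldr (\<lambda>i. foldr (\<lambda>b. letter b (x i)) [Suc i..<n]) (rev [a..<n]) f)"
  using assms
proof (induction a arbitrary: f rule: inc_induct)
  case (step a)
  have comm: "foldr (\<lambda>i. foldr (\<lambda>b. letter b (x i)) [Suc i..<n]) is (letter a y F) =
      letter a y (foldr (\<lambda>i. foldr (\<lambda>b. letter b (x i)) [Suc i..<n]) is F)"
    if "\<forall>i\<in>set is. a < i" for "is" y F
    using that
  proof (induction "is")
    case (Cons i "is")
    then have "foldr (\<lambda>b. letter b (x i)) [Suc i..<n] (letter a y G) =
        letter a y (foldr (\<lambda>b. letter b (x i)) [Suc i..<n] G)" for G
      by (intro letter_commute_letters) auto
    with Cons show ?case by simp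
  qed simp
  have eq: "rev [a..<n] = rev [Suc a..<n] @ [a]" "[a..<n] = a # [Suc a..<n]"
    using step.hyps by (simp_all add: upt_conv_Cons)
  show ?case
    unfolding eq(1) foldr_append by (simp add: step.IH comm eq(2))
qed simp

text \<open>After the letters with \<open>a = i\<close> are collected in front, the remaining block
  of \<open>i\<close> starts at \<open>Suc i\<close>; renaming \<open>Suc i\<close> to
  \<open>i\<close> gives the smaller instance and shifts the parameters.\<close>

lemma words_gf_rec:
  assumes "m < n"
  shows "words_gf n m x f =
    foldr (\<lambda>i. letter i (x i)) (rev [Suc m..<n]) (words_gf n (Suc m) (\<lambda>i. x (i - 1)) f)"
proof -
  let ?E = "\<lambda>i. foldr (\<lambda>b. letter b (x i)) [Suc i..<n]"
  have shift: "foldr (\<lambda>i. foldr (\<lambda>b. letter b (x (i - 1))) [i..<n]) (map Suc is) f = foldr ?E is f" for "is"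
    by (induction "is") simp_all
  have "words_gf n (Suc m) (\<lambda>i. x (i - 1)) f = foldr ?E (rev [Suc m..<n]) f"
  proof (cases "Suc m < n")
    case True
    then obtain n' where n': "n = Suc n'" "Suc m \<le> n'" by (cases n) auto
    have "words_gf n (Suc m) (\<lambda>i. x (i - 1)) f = foldr ?E (rev [Suc m..<n']) f"
      unfolding words_gf_altdef shift[of "rev [Suc m..<n']", symmetric]
        rev_map[symmetric] map_Suc_upt by (simp add: n'(1) del: upt_Suc)
    moreover have "rev [Suc m..<n] = n' # rev [Suc m..<n']"
      using n' by simp
    \<comment> \<open>The block of the largest index has lost its only letter and
      disappears.\<close>
    moreover have "[Suc n'..<n] = []"
      by (simp add: n'(1))
    ultimately show ?thesis by (simp only: foldr.simps o_apply id_apply)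
  next
    case False
    then show ?thesis by (simp add: words_gf_altdef)
  qed
  then show ?thesis
    using assms by (simp add: words_gf_altdef[of n m] letters_extract_first)
qed

section \<open>The recursion for the whole grid\<close>

definition grid_gf where
  "grid_gf n m x g = foldr (\<lambda>i. row i (x i) (rev [Suc m..<Suc n])) [Suc m..<Suc n] g"

text \<open>\<open>row_full\<close> sets the last parameter to 0, \<open>rows_move_zero\<close>
  lifts that row to the top, \<open>row_zero_straight\<close> sends its pipe into column
  \<open>Suc m\<close>, and \<open>rows_full_column\<close> deletes this column from the rows below.
  These carry the shifted parameters \<open>x (i - 1)\<close>.\<close>

lemma grid_gf_rec:
  assumes "m < n"
    and "\<And>i. i \<in> {Suc m..n} \<Longrightarrow> h_closed g i" "\<And>j. j \<in> {Suc m..n} \<Longrightarrow> v_full g j"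
    and "\<And>i. i \<in> {Suc m..n} \<Longrightarrow> h i \<noteq> 0" "\<And>j. j \<in> {Suc m..n} \<Longrightarrow> v j = 0"
  shows "grid_gf n m x g h v =
    foldr (\<lambda>i. letter i (x i)) (rev [Suc m..<n])
      (\<lambda>h. grid_gf n (Suc m) (\<lambda>i. x (i - 1)) g (h(Suc m := 0)) (v(Suc m := h (Suc m)))) h"
proof -
  let ?js = "rev [Suc m..<Suc n]" and ?js' = "rev [Suc (Suc m)..<Suc n]" and ?a = "Suc m"
  let ?G = "foldr (\<lambda>i. row (Suc i) (x i) ?js) [?a..<n] g"
  have js: "?js = ?js' @ [?a]"
    using assms(1) by (simp add: upt_conv_Cons del: upt_Suc)
  have upt: "[?a..<Suc n] = [?a..<n] @ [n]"
    using assms(1) by simp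
  have "grid_gf n m x g = foldr (\<lambda>i. row i (x i) ?js) [?a..<n] (row n (x n) ?js g)"
    unfolding grid_gf_def by (subst (2) upt) (simp del: upt_Suc)
  also have "row n (x n) ?js g = row n 0 ?js g"
    using assms(3) by (intro row_full) auto
  also have "foldr (\<lambda>i. row i (x i) ?js) [?a..<n] (row n 0 ?js g) =
      foldr (\<lambda>i. cross i (Suc i) (x i)) (rev [?a..<n]) (row ?a 0 ?js ?G)"
    using assms(1,2) by (intro rows_move_zero) auto
  finally have "grid_gf n m x g h v =
      foldr (\<lambda>i. letter i (x i)) (rev [?a..<n]) (\<lambda>h. row ?a 0 ?js ?G h v) h"
    by (simp add: crosses_eq_letters)
  also have "\<dots> = foldr (\<lambda>i. letter i (x i)) (rev [Suc m..<n])
      (\<lambda>h. grid_gf n (Suc m) (\<lambda>i. x (i - 1)) g (h(Suc m := 0)) (v(Suc m := h (Suc m)))) h"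
  proof (rule letters_cong_nonzero[where S = "{?a..n}" and h = h])
    fix u :: "nat \<Rightarrow> nat"
    assume u: "\<forall>i\<in>{?a..n}. u i \<noteq> 0"
    have "h_closed ?G ?a"
      using assms(1,2) by (intro h_closed_rows) auto
    then have "row ?a 0 ?js ?G u v = ?G (u(?a := 0)) (v(?a := u ?a))"
      unfolding js using assms(1,5) u by (intro row_zero_straight) (auto simp del: upt_Suc)
    also have "\<dots> = foldr (\<lambda>i. row (Suc i) (x i) ?js') [?a..<n] g (u(?a := 0)) (v(?a := u ?a))"
      unfolding js using assms(1,2) u by (intro rows_full_column) (auto simp: distinct_map)
    also have "\<dots> = grid_gf n (Suc m) (\<lambda>i. x (i - 1)) g (u(?a := 0)) (v(?a := u ?a))"
      by (simp add: grid_gf_def map_Suc_upt[symmetric] foldr_map o_def del: upt_Suc)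
    finally show "row ?a 0 ?js ?G u v = \<dots>" .
  qed (use assms(1,4) in auto)
  finally show ?thesis .
qed

text \<open>Both sides satisfy the same recursion. The labels \<open>h\<close> and \<open>v\<close>
  must be arbitrary, since each stage empties one more row edge and fixes the label of one more
  column.\<close>

theorem grid_gf_eq_words_gf:
  assumes "m \<le> n"
    and "\<And>i. i \<in> {Suc m..n} \<Longrightarrow> h_closed g i" "\<And>j. j \<in> {Suc m..n} \<Longrightarrow> v_full g j"
    and "\<And>i. i \<in> {Suc m..n} \<Longrightarrow> h i \<noteq> 0" "\<And>j. j \<in> {Suc m..n} \<Longrightarrow> v j = 0"
  shows "grid_gf n m x g h v =
    words_gf n m x (\<lambda>u. g (\<lambda>i. if i \<in> {Suc m..n} then 0 else h i)
      (\<lambda>j. if j \<in> {Suc m..n} then u j else v j)) h"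
  using assms
proof (induction m arbitrary: x h v rule: inc_induct)
  case base
  then show ?case by (simp add: grid_gf_def words_gf_altdef)
next
  case (step m)
  let ?a = "Suc m"
  let ?F = "\<lambda>h u. g (\<lambda>i. if i \<in> {?a..n} then 0 else h i) (\<lambda>j. if j \<in> {?a..n} then u j else v j)"
  have "grid_gf n m x g h v = foldr (\<lambda>i. letter i (x i)) (rev [?a..<n])
      (\<lambda>h. grid_gf n ?a (\<lambda>i. x (i - 1)) g (h(?a := 0)) (v(?a := h ?a))) h"
    using step by (intro grid_gf_rec) auto
  also have "\<dots> = foldr (\<lambda>i. letter i (x i)) (rev [?a..<n]) (words_gf n ?a (\<lambda>i. x (i - 1)) (?F h)) h"
  proof (rule letters_cong_nonzero[where S = "{?a..n}" and h = h])
    fix u :: "nat \<Rightarrow> nat"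
    assume u: "\<forall>i\<in>{?a..n}. u i \<noteq> 0" and u_eq: "\<forall>i. i \<notin> {?a..n} \<longrightarrow> u i = h i"
    \<comment> \<open>The observable of the smaller instance: position \<open>?a\<close> is no
      longer read from the word but from the label \<open>u ?a\<close> already placed in column
      \<open>?a\<close>.\<close>
    let ?F' = "\<lambda>u'. g (\<lambda>i. if i \<in> {Suc ?a..n} then 0 else (u(?a := 0)) i)
      (\<lambda>j. if j \<in> {Suc ?a..n} then u' j else (v(?a := u ?a)) j)"
    have letters: "snd b \<noteq> ?a \<and> Suc (snd b) \<noteq> ?a" if "b \<in> set (biletter_seq n ?a)" for b
      using that by (auto simp: biletter_seq_def)
    have "grid_gf n ?a (\<lambda>i. x (i - 1)) g (u(?a := 0)) (v(?a := u ?a)) =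
        words_gf n ?a (\<lambda>i. x (i - 1)) ?F' (u(?a := 0))"
      using step.prems u by (intro step.IH) auto
    \<comment> \<open>The remaining letters touch only positions beyond \<open>?a\<close>, so the
      value at \<open>?a\<close> can be changed before or after them; this turns \<open>?F'\<close>
      into \<open>?F h\<close>.\<close>
    also have "\<dots> = words_gf n ?a (\<lambda>i. x (i - 1)) (\<lambda>u'. ?F' (u'(?a := 0))) u"
      unfolding words_gf_def by (rule letters_fun_upd[OF letters])
    also have "(\<lambda>u'. ?F' (u'(?a := 0))) = (\<lambda>u'. ?F h (u'(?a := u ?a)))"
    proof
      fix u'
      have "(\<lambda>i. if i \<in> {Suc ?a..n} then 0 else (u(?a := 0)) i) =
          (\<lambda>i. if i \<in> {?a..n} then 0 else h i)"
        using step.hyps u_eq by (auto simp: fun_eq_iff)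
      moreover have "(\<lambda>j. if j \<in> {Suc ?a..n} then (u'(?a := 0)) j else (v(?a := u ?a)) j) =
          (\<lambda>j. if j \<in> {?a..n} then (u'(?a := u ?a)) j else v j)"
        using step.hyps by (auto simp: fun_eq_iff)
      ultimately show "?F' (u'(?a := 0)) = ?F h (u'(?a := u ?a))"
        by (simp only:)
    qed
    also have "words_gf n ?a (\<lambda>i. x (i - 1)) (\<lambda>u'. ?F h (u'(?a := u ?a))) u =
        words_gf n ?a (\<lambda>i. x (i - 1)) (?F h) (u(?a := u ?a))"
      unfolding words_gf_def by (rule letters_fun_upd[OF letters, symmetric])
    finally show "grid_gf n ?a (\<lambda>i. x (i - 1)) g (u(?a := 0)) (v(?a := u ?a)) =
      words_gf n ?a (\<lambda>i. x (i - 1)) (?F h) u"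
      by (simp only: fun_upd_triv)
  qed (use step in auto)
  also have "\<dots> = words_gf n m x (?F h) h"
    using step.hyps by (simp add: words_gf_rec)
  finally show ?case .
qed

section \<open>The Demazure product and reverse compatible pairs\<close>

definition inversions :: "nat \<Rightarrow> (nat \<Rightarrow> nat) \<Rightarrow> (nat \<times> nat) set" where
  "inversions n u = {(p, q). 1 \<le> p \<and> p < q \<and> q \<le> n \<and> u q < u p}"

lemma finite_inversions [simp]: "finite (inversions n u)"
  by (rule finite_subset[of _ "{..n} \<times> {..n}"]) (auto simp: inversions_def)

lemma inversions_id [simp]: "inversions n id = {}"
  by (auto simp: inversions_def)

text \<open>Apart from the pair \<open>(a, Suc a)\<close>, which becomes an inversion, the
  reflection maps the inversions of \<open>u\<close> bijectively to those of the composite.\<close>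

lemma card_inversions_swap:
  assumes "1 \<le> a" "a < n" "u a < u (Suc a)"
  shows "card (inversions n (u \<circ> simple_refl a)) = Suc (card (inversions n u))"
proof -
  let ?s = "simple_refl a"
  have inj: "inj (map_prod ?s ?s)"
    by (intro prod.inj_map) auto
  have mono: "?s p < ?s q" if "p < q" "(p, q) \<noteq> (a, Suc a)" for p q
    using that by (auto simp: transpose_def)
  have range: "1 \<le> ?s p \<and> ?s p \<le> n" if "1 \<le> p" "p \<le> n" for p
    using that assms by (auto simp: transpose_def)
  have sub: "map_prod ?s ?s ` (inversions n w - {(a, Suc a)}) \<subseteq> inversions n (w \<circ> ?s) - {(a, Suc a)}" for w
    using mono range by (auto simp: inversions_def transpose_eq_iff)
  have "inversions n (u \<circ> ?s) - {(a, Suc a)} = map_prod ?s ?s ` (inversions n u - {(a, Suc a)})"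
  proof
    \<comment> \<open>The reverse inclusion is \<open>sub\<close> for the composite, since the
      reflection is an involution.\<close>
    have "map_prod ?s ?s ` map_prod ?s ?s ` (inversions n (u \<circ> ?s) - {(a, Suc a)}) \<subseteq>
        map_prod ?s ?s ` (inversions n (u \<circ> ?s \<circ> ?s) - {(a, Suc a)})"
      by (rule image_mono) (rule sub)
    moreover have "map_prod ?s ?s ` map_prod ?s ?s ` A = A" for A
      by (simp add: image_image map_prod_def case_prod_beta)
    moreover have "u \<circ> ?s \<circ> ?s = u" by (simp add: comp_assoc)
    ultimately show "inversions n (u \<circ> ?s) - {(a, Suc a)} \<subseteq> map_prod ?s ?s ` (inversions n u - {(a, Suc a)})"
      by simp
  qed (rule sub)
  moreover have "(a, Suc a) \<in> inversions n (u \<circ> ?s)" "(a, Suc a) \<notin> inversions n u"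
    using assms by (auto simp: inversions_def)
  ultimately show ?thesis
    by (metis card_Suc_Diff1 card_image finite_inversions inj inj_on_subset subset_UNIV Diff_insert0 Diff_empty)
qed

lemma card_inversions_swap':
  assumes "1 \<le> a" "a < n" "u (Suc a) < u a"
  shows "card (inversions n u) = Suc (card (inversions n (u \<circ> simple_refl a)))"
  using card_inversions_swap[of a n "u \<circ> simple_refl a"] assms by (simp add: comp_assoc)

lemma simple_refl_permutes: "1 \<le> a \<Longrightarrow> a < n \<Longrightarrow> simple_refl a permutes {1..n}"
  by (intro permutes_swap_id) auto

lemma inv_simple_refl_comp:
  assumes "bij w"
  shows "inv (simple_refl a \<circ> w) = inv w \<circ> simple_refl a"
  using assms by (simp add: o_inv_distrib)

lemma permutes_eq_id_of_no_descent:
  assumes "u permutes {1..n}" "\<And>a. 1 \<le> a \<Longrightarrow> a < n \<Longrightarrow> u a < u (Suc a)"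
  shows "u = id"
proof (rule permutes_natset_ge[OF assms(1)], rule ballI)
  fix i assume "i \<in> {1..n}"
  then have "1 \<le> i" "i \<le> n" by auto
  then show "i \<le> u i"
  proof (induction i rule: dec_induct)
    case base
    then show ?case
      using permutes_in_image[OF assms(1), of 1] by auto
  next
    case (step i)
    then show ?case
      using assms(2)[of i] by auto
  qed
qed

definition word_perm :: "nat list \<Rightarrow> nat \<Rightarrow> nat" where
  "word_perm as = foldr (\<lambda>a u. simple_refl a \<circ> u) as id"

lemma word_perm_Nil: "word_perm [] = id"
  by (simp add: word_perm_def fun_eq_iff)

lemma word_perm_Cons: "word_perm (a # as) = simple_refl a \<circ> word_perm as"
  by (simp add: word_perm_def fun_eq_iff)

lemma word_perm_permutes:
  assumes "set as \<subseteq> {1..<n}"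
  shows "word_perm as permutes {1..n}"
  using assms
proof (induction as)
  case Nil
  show ?case unfolding word_perm_Nil by (rule permutes_id)
next
  case (Cons a as)
  then show ?case
    unfolding word_perm_Cons by (intro permutes_compose simple_refl_permutes) auto
qed

lemma card_inversions_word_perm_le:
  assumes "set as \<subseteq> {1..<n}"
  shows "card (inversions n (inv (word_perm as))) \<le> length as"
  using assms
proof (induction as)
  case Nil
  show ?case unfolding word_perm_Nil inv_id inversions_id by simp
next
  case (Cons a as)
  let ?w = "word_perm as"
  have w: "?w permutes {1..n}"
    using Cons.prems by (intro word_perm_permutes) auto
  have a: "1 \<le> a" "a < n" using Cons.prems by auto
  have "inv (word_perm (a # as)) = inv ?w \<circ> simple_refl a"
    using inv_simple_refl_comp[OF permutes_bij[OF w], of a] by (simp only: word_perm_Cons)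
  moreover have "inv ?w a \<noteq> inv ?w (Suc a)"
    using permutes_inj[OF permutes_inv[OF w]] by (simp add: inj_eq)
  ultimately have "card (inversions n (inv (word_perm (a # as)))) \<le> Suc (card (inversions n (inv ?w)))"
    using card_inversions_swap[OF a, of "inv ?w"] card_inversions_swap'[OF a, of "inv ?w"]
    by (cases "inv ?w a < inv ?w (Suc a)") auto
  with Cons show ?case by auto
qed

lemma ex_word_of_card_inversions:
  assumes "w permutes {1..n}"
  shows "\<exists>as. length as = card (inversions n (inv w)) \<and> set as \<subseteq> {1..<n} \<and> w = word_perm as"
  using assms
proof (induction "card (inversions n (inv w))" arbitrary: w rule: less_induct)
  case less
  let ?u = "inv w"
  have u: "?u permutes {1..n}" using less.prems by (rule permutes_inv)
  show ?case
  proof (cases "\<exists>a. 1 \<le> a \<and> a < n \<and> \<not> ?u a < ?u (Suc a)")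
    case False
    then have "?u = id"
      by (intro permutes_eq_id_of_no_descent[OF u]) auto
    moreover have "inv ?u = w" using permutes_inv_inv[OF less.prems] .
    ultimately have "w = id" by simp
    then show ?thesis
      using \<open>?u = id\<close> by (intro exI[of _ "[]"] conjI) (simp_all only: word_perm_Nil inversions_id, simp_all)
  next
    case True
    then obtain a where a: "1 \<le> a" "a < n" "\<not> ?u a < ?u (Suc a)" by blast
    then have "?u (Suc a) < ?u a"
      using permutes_inj[OF u] by (metis inj_eq n_not_Suc_n nat_neq_iff)
    from card_inversions_swap'[OF a(1,2) this]
    have card: "card (inversions n ?u) = Suc (card (inversions n (inv (simple_refl a \<circ> w))))"
      using inv_simple_refl_comp[OF permutes_bij[OF less.prems], of a] by simp
    moreover have "simple_refl a \<circ> w permutes {1..n}"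
      using less.prems a by (intro permutes_compose simple_refl_permutes)
    ultimately obtain as where as: "length as = card (inversions n (inv (simple_refl a \<circ> w)))"
      "set as \<subseteq> {1..<n}" "simple_refl a \<circ> w = word_perm as"
      using less.hyps[of "simple_refl a \<circ> w"] by auto
    have "simple_refl a \<circ> (simple_refl a \<circ> w) = w"
      by (simp add: comp_assoc[symmetric])
    then have "w = word_perm (a # as)"
      using as(3) by (simp only: word_perm_Cons)
    with as card a show ?thesis
      by (intro exI[of _ "a # as"]) simp
  qed
qed

text \<open>The inverse appears because a left factor \<open>simple_refl a\<close> of
  \<open>w\<close> swaps two adjacent positions of \<open>inv w\<close>, changing its inversion
  number by one. So no word is shorter, and removing descents one at a time produces a word of
  exactly this length.\<close>

lemma coxeter_length_eq:
  assumes "w permutes {1..n}"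
  shows "coxeter_length n w = card (inversions n (inv w))"
  unfolding coxeter_length_def word_perm_def[symmetric]
proof (rule Least_equality)
  show "\<exists>as. length as = card (inversions n (inv w)) \<and> set as \<subseteq> {1..<n} \<and> w = word_perm as"
    using assms by (rule ex_word_of_card_inversions)
qed (use card_inversions_word_perm_le in blast)

lemma demazure_eq:
  assumes "w permutes {1..n}" "1 \<le> a" "a < n"
  shows "demazure n a w = (if inv w a < inv w (Suc a) then simple_refl a \<circ> w else w)"
proof -
  have "simple_refl a \<circ> w permutes {1..n}"
    using assms by (intro permutes_compose simple_refl_permutes)
  moreover have "inv w a \<noteq> inv w (Suc a)"
    using permutes_inj[OF permutes_inv[OF assms(1)]] by (simp add: inj_eq)
  ultimately show ?thesis
    using card_inversions_swap[OF assms(2,3), of "inv w"] card_inversions_swap'[OF assms(2,3), of "inv w"]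
    by (cases "inv w a < inv w (Suc a)")
      (simp_all add: demazure_def coxeter_length_eq assms(1) inv_simple_refl_comp
        permutes_bij[OF assms(1)] del: One_nat_def)
qed

lemma demazure_permutes:
  assumes "w permutes {1..n}" "1 \<le> a" "a < n"
  shows "demazure n a w permutes {1..n}"
  using assms by (auto simp: demazure_eq simp del: One_nat_def
      intro!: permutes_compose simple_refl_permutes)

text \<open>On the word \<open>inv w\<close>, an ascent at \<open>a\<close> gives the swapped word
  with factor \<open>x\<close>; at a descent the coefficient \<open>1 + x\<close> of
  \<open>exch\<close> reflects that the Demazure product leaves \<open>w\<close> unchanged.\<close>

lemma letter_inv:
  assumes "w permutes {1..n}" "1 \<le> a" "a < n"
  shows "letter a x f (inv w) = f (inv w) + x * f (inv (demazure n a w))"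
proof -
  let ?u = "inv w"
  have u: "?u permutes {1..n}" using assms(1) by (rule permutes_inv)
  have "?u a \<noteq> 0" "?u (Suc a) \<noteq> 0"
    using permutes_in_image[OF u, of a] permutes_in_image[OF u, of "Suc a"] assms(2,3) by auto
  moreover have "?u(a := ?u (Suc a), Suc a := ?u a) = ?u \<circ> simple_refl a"
    by (auto simp: fun_eq_iff transpose_def)
  moreover have "?u(a := ?u a, Suc a := ?u (Suc a)) = ?u" by simp
  ultimately show ?thesis
    using assms by (simp add: letter_def exch_def demazure_eq inv_simple_refl_comp permutes_bij
        algebra_simps del: fun_upd_apply)
qed

section \<open>Expansion of the product of letters over reverse compatible pairs\<close>

abbreviation demazure_word :: "nat \<Rightarrow> biletter list \<Rightarrow> (nat \<Rightarrow> nat) \<Rightarrow> nat \<Rightarrow> nat" where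
  "demazure_word n B w \<equiv> fold (\<lambda>(i, a) w. demazure n a w) B w"

lemma demazure_word_permutes:
  assumes "w permutes {1..n}" "set B \<subseteq> biletters n"
  shows "demazure_word n B w permutes {1..n}"
  using assms
proof (induction B arbitrary: w)
  case (Cons b B)
  obtain i a where b: "b = (i, a)" by force
  then have "1 \<le> a" "a < n" using Cons.prems by (auto simp: biletters_def)
  with Cons.prems have "demazure n a w permutes {1..n}" by (intro demazure_permutes)
  then show ?case using Cons by (simp add: b)
qed simp

text \<open>Multiplying out: the subsequence \<open>B\<close> records the letters at which the
  second summand of \<open>letter_inv\<close> is chosen.\<close>

lemma letters_eq_sum_subseqs:
  assumes "w permutes {1..n}" "set bs \<subseteq> biletters n"
  shows "foldr (\<lambda>(i, a). letter a (x i)) bs f (inv w) =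
    (\<Sum>B\<leftarrow>subseqs bs. prod_list (map (\<lambda>b. x (fst b)) B) * f (inv (demazure_word n B w)))"
  using assms
proof (induction bs arbitrary: w)
  case (Cons b bs)
  obtain i a where b: "b = (i, a)" by force
  then have a: "1 \<le> a" "a < n" using Cons.prems by (auto simp: biletters_def)
  have "demazure n a w permutes {1..n}"
    using Cons.prems a by (intro demazure_permutes)
  with Cons have IH: "foldr (\<lambda>(i, a). letter a (x i)) bs f (inv w') =
      (\<Sum>B\<leftarrow>subseqs bs. prod_list (map (\<lambda>b. x (fst b)) B) * f (inv (demazure_word n B w')))"
    if "w' \<in> {w, demazure n a w}" for w'
    using that by auto
  show ?case
    by (simp add: b letter_inv[OF Cons.prems(1) a] IH Let_def o_def
        sum_list_const_mult[symmetric] mult.assoc add.commute)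
qed simp

text \<open>If the head \<open>b\<close> of the sorted list occurs in a sorted \<open>B\<close>, it
  must be the first entry and occur only once: an earlier entry \<open>c\<close> would give both
  \<open>R c b\<close> and \<open>R b c\<close>.\<close>

lemma set_subseqs_sorted_wrt:
  assumes "sorted_wrt R bs" "asymp R"
  shows "set (subseqs bs) = {B. set B \<subseteq> set bs \<and> sorted_wrt R B}"
  using assms(1)
proof (induction bs)
  case (Cons b bs)
  have irrefl: "\<not> R c c" for c
    using assms(2) by (auto dest: asympD)
  have "B \<in> set (subseqs (b # bs)) \<longleftrightarrow> set B \<subseteq> set (b # bs) \<and> sorted_wrt R B" for B
  proof (cases B)
    case (Cons c B')
    have "c = b" "b \<notin> set B'" if "set B \<subseteq> set (b # bs)" "sorted_wrt R B" "b \<in> set B"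
    proof -
      show "c = b"
      proof (rule ccontr)
        assume "c \<noteq> b"
        then have "R c b" "R b c"
          using that Cons \<open>sorted_wrt R (b # bs)\<close> by auto
        then show False using assms(2) by (auto dest: asympD)
      qed
      then show "b \<notin> set B'"
        using that Cons irrefl by auto
    qed
    then show ?thesis
      using Cons.IH \<open>sorted_wrt R (b # bs)\<close> irrefl Cons
      by (auto simp: Let_def image_iff)
  qed (use Cons in \<open>auto simp: Let_def\<close>)
  then show ?case by blast
qed auto

lemma asymp_biletter_greater: "asymp biletter_greater"
  by (intro asympI) auto

lemma sorted_biletter_seq: "sorted_wrt biletter_greater (biletter_seq n m)"
proof -
  have "sorted_wrt biletter_greater (concat (map (\<lambda>i. map (Pair i) [i..<n]) is))"
    if "sorted_wrt (>) is" for "is"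
    using that
    by (induction "is") (auto simp: sorted_wrt_append sorted_wrt_map)
  moreover have "sorted_wrt (>) (rev [Suc m..<n])"
    by (simp add: sorted_wrt_rev)
  ultimately show ?thesis by (simp add: biletter_seq_def)
qed

lemma set_biletter_seq: "set (biletter_seq n 0) = biletters n"
  by (force simp: biletter_seq_def biletters_def)

lemma RCP_eq_subseqs: "RCP n = set (subseqs (biletter_seq n 0))"
  by (simp add: RCP_def set_subseqs_sorted_wrt[OF sorted_biletter_seq asymp_biletter_greater]
      set_biletter_seq)

lemma finite_RCP: "finite (RCP n)"
  by (simp add: RCP_eq_subseqs)

lemma words_gf_eq_sum_RCP:
  "words_gf n 0 x f id =
    (\<Sum>B\<in>RCP n. prod_list (map (\<lambda>b. x (fst b)) B) * f (inv (perm_RCP n B)))"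
proof -
  have "distinct (biletter_seq n 0)"
    using sorted_biletter_seq[of n 0] asymp_biletter_greater
    by (metis distinct_conv_nth sorted_wrt_nth_less asympD nat_neq_iff)
  then have "distinct (subseqs (biletter_seq n 0))"
    using distinct_set_subseqs by (auto simp: distinct_map)
  moreover have "inv id = (id :: nat \<Rightarrow> nat)" by simp
  ultimately show ?thesis
    using letters_eq_sum_subseqs[of id n "biletter_seq n 0" x f]
    by (simp add: words_gf_def RCP_eq_subseqs permutes_id set_biletter_seq perm_RCP_def
        sum_list_distinct_conv_sum_set)
qed

section \<open>Pipedreams as states of the vertex model\<close>

fun out_left :: "tile \<Rightarrow> nat \<Rightarrow> nat \<Rightarrow> nat" where
  "out_left Horiz t r = r"
| "out_left JTile t r = t"
| "out_left MarkedJ t r = t"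
| "out_left Plus t r = max t r"
| "out_left _ t r = 0"

fun out_bottom :: "tile \<Rightarrow> nat \<Rightarrow> nat \<Rightarrow> nat" where
  "out_bottom Vert t r = t"
| "out_bottom RTile t r = r"
| "out_bottom Plus t r = min t r"
| "out_bottom _ t r = 0"

definition fits :: "tile \<Rightarrow> nat \<Rightarrow> nat \<Rightarrow> bool" where
  "fits T t r \<longleftrightarrow> (conn_top T \<longleftrightarrow> t \<noteq> 0) \<and> (conn_right T \<longleftrightarrow> r \<noteq> 0)"

definition tile_wt :: "'a::comm_semiring_1 \<Rightarrow> tile \<Rightarrow> 'a" where
  "tile_wt x T = (if heavy T then x else 1)"

lemma UNIV_tile: "UNIV = {Blank, Horiz, Vert, Plus, RTile, JTile, MarkedJ}"
  using tile.exhaust by blast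

lemma finite_tile [simp]: "finite (UNIV :: tile set)"
  by (simp add: UNIV_tile)

lemma out_nonzero:
  assumes "fits T t r"
  shows "out_left T t r \<noteq> 0 \<longleftrightarrow> conn_left T" "out_bottom T t r \<noteq> 0 \<longleftrightarrow> conn_bottom T"
  using assms by (cases T; auto simp: fits_def max_def min_def)+

lemma vertex_eq_sum:
  "vertex x t r k = (\<Sum>T\<in>UNIV. if fits T t r then tile_wt x T * k (out_left T t r) (out_bottom T t r) else 0)"
  by (simp add: UNIV_tile vertex_def fits_def tile_wt_def heavy_def algebra_simps)

fun flow_step :: "tile_matrix \<Rightarrow> nat \<times> nat \<Rightarrow> (nat \<Rightarrow> nat) \<times> (nat \<Rightarrow> nat) \<Rightarrow> (nat \<Rightarrow> nat) \<times> (nat \<Rightarrow> nat)" where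
  "flow_step D (i, j) (h, v) =
     (h(i := out_left (D (i, j)) (v j) (h i)), v(j := out_bottom (D (i, j)) (v j) (h i)))"

fun fits_run :: "tile_matrix \<Rightarrow> (nat \<times> nat) list \<Rightarrow> (nat \<Rightarrow> nat) \<times> (nat \<Rightarrow> nat) \<Rightarrow> bool" where
  "fits_run D [] s \<longleftrightarrow> True"
| "fits_run D ((i, j) # cs) (h, v) \<longleftrightarrow>
     fits (D (i, j)) (v j) (h i) \<and> fits_run D cs (flow_step D (i, j) (h, v))"

lemma fits_run_append:
  "fits_run D (cs @ cs') s \<longleftrightarrow> fits_run D cs s \<and> fits_run D cs' (fold (flow_step D) cs s)"
  by (induction D cs s rule: fits_run.induct) auto

lemma run_cong:
  assumes "\<And>c. c \<in> set cs \<Longrightarrow> D c = D' c"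
  shows "fits_run D cs s = fits_run D' cs s \<and> fold (flow_step D) cs s = fold (flow_step D') cs s"
  using assms by (induction D cs s rule: fits_run.induct) auto

text \<open>Expands the nested tile sums into one sum over tilings by splitting off the tile
  \<open>T\<close> of the first visited cell.\<close>

lemma cells_eq_sum:
  assumes "distinct cs"
  shows "foldr (\<lambda>(i, j). cell i j (x i)) cs g h v =
    (\<Sum>D\<in>set cs \<rightarrow>\<^sub>E UNIV. if fits_run D cs (h, v)
       then (\<Prod>c\<in>set cs. tile_wt (x (fst c)) (D c)) * case_prod g (fold (flow_step D) cs (h, v)) else 0)"
  using assms
proof (induction cs arbitrary: h v)
  case (Cons c cs)
  obtain i j where c: "c = (i, j)" by force
  have notin: "c \<notin> set cs" using Cons.prems by simp
  let ?S = "\<lambda>D h v. if fits_run D cs (h, v)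
       then (\<Prod>c\<in>set cs. tile_wt (x (fst c)) (D c)) * case_prod g (fold (flow_step D) cs (h, v)) else 0"
  let ?S' = "\<lambda>D. if fits_run D (c # cs) (h, v)
       then (\<Prod>c\<in>set (c # cs). tile_wt (x (fst c)) (D c)) * case_prod g (fold (flow_step D) (c # cs) (h, v)) else 0"
  let ?up = "\<lambda>(T, D). D(c := T)"
  \<comment> \<open>Since \<open>c\<close> is not visited again, its tile influences only the first
    step and its own weight factor.\<close>
  have step: "?S' (D(c := T)) =
      (if fits T (v j) (h i) then tile_wt (x i) T *
         ?S D (h(i := out_left T (v j) (h i))) (v(j := out_bottom T (v j) (h i))) else 0)" for D T
  proof -
    have "(D(c := T)) c' = D c'" if "c' \<in> set cs" for c'
      using that notin by auto
    note cong = this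
    have "(\<Prod>d\<in>set cs. tile_wt (x (fst d)) ((D(c := T)) d)) = (\<Prod>d\<in>set cs. tile_wt (x (fst d)) (D d))"
      by (rule prod.cong[OF refl]) (simp only: cong)
    then show ?thesis
      using run_cong[of cs "D(c := T)" D, OF cong] notin
      by (simp add: c mult.assoc del: fun_upd_apply) (simp add: mult.assoc)
  qed
  have "(\<Sum>D\<in>set (c # cs) \<rightarrow>\<^sub>E UNIV. ?S' D) = (\<Sum>D\<in>?up ` (UNIV \<times> (set cs \<rightarrow>\<^sub>E UNIV)). ?S' D)"
    by (simp only: list.set PiE_insert_eq)
  also have "\<dots> = (\<Sum>p\<in>UNIV \<times> (set cs \<rightarrow>\<^sub>E UNIV). ?S' (?up p))"
    using inj_combinator[OF notin, of "\<lambda>_. UNIV"] by (subst sum.reindex) (auto simp: o_def)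
  also have "\<dots> = (\<Sum>T\<in>UNIV. \<Sum>D\<in>set cs \<rightarrow>\<^sub>E UNIV. ?S' (D(c := T)))"
    by (subst sum.cartesian_product) (intro sum.cong refl, auto)
  also have "\<dots> = (\<Sum>T\<in>UNIV. if fits T (v j) (h i) then tile_wt (x i) T *
         (\<Sum>D\<in>set cs \<rightarrow>\<^sub>E UNIV. ?S D (h(i := out_left T (v j) (h i))) (v(j := out_bottom T (v j) (h i)))) else 0)"
    unfolding step by (intro sum.cong refl) (simp add: sum_distrib_left)
  also have "\<dots> = cell i j (x i) (foldr (\<lambda>(i, j). cell i j (x i)) cs g) h v"
    unfolding cell_def[of i j "x i"] vertex_eq_sum using Cons by (intro sum.cong refl) simp
  finally show ?case by (simp only: c foldr.simps o_apply prod.case)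
qed simp

lemma grid_gf_eq_cells: "grid_gf n 0 x g = foldr (\<lambda>(i, j). cell i j (x i)) (reading_order n) g"
proof -
  have *: "foldr (\<lambda>(i, j). cell i j (x i)) (map (\<lambda>j. (i, j)) js) g = row i (x i) js g" for i js and g
    by (induction js) auto
  have "foldr (\<lambda>(i, j). cell i j (x i)) (concat (map (\<lambda>i. map (\<lambda>j. (i, j)) js) is)) g =
      foldr (\<lambda>i. row i (x i) js) is g" for "is" js
    by (induction "is") (simp_all add: *)
  then show ?thesis by (simp add: grid_gf_def reading_order_def)
qed

lemma set_reading_order: "set (reading_order n) = {1..n} \<times> {1..n}"
  by (force simp: reading_order_def simp del: upt_Suc)

lemma distinct_reading_order: "distinct (reading_order n)"
proof -
  have "distinct (concat (map (\<lambda>i. map (\<lambda>j. (i, j)) js) is))" if "distinct is" "distinct js" for "is" js :: "nat list"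
    using that by (induction "is") (auto simp: distinct_map inj_on_def)
  then show ?thesis by (simp add: reading_order_def)
qed

section \<open>Fitting runs and the matching conditions of \<open>MBPD\<close>\<close>

definition row_cells :: "nat \<Rightarrow> nat \<Rightarrow> nat \<Rightarrow> (nat \<times> nat) list" where
  "row_cells n k i = map (\<lambda>j. (i, j)) (rev [Suc k..<Suc n])"

definition rows_cells :: "nat \<Rightarrow> nat \<Rightarrow> (nat \<times> nat) list" where
  "rows_cells n m = concat (map (row_cells n 0) [1..<Suc m])"

lemma row_cells_full: "row_cells n n i = []"
  by (simp add: row_cells_def)

lemma row_cells_step: "k < n \<Longrightarrow> row_cells n k i = row_cells n (Suc k) i @ [(i, Suc k)]"
  by (simp add: row_cells_def upt_conv_Cons del: upt_Suc)

lemma rows_cells_0: "rows_cells n 0 = []"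
  by (simp add: rows_cells_def)

lemma rows_cells_Suc: "rows_cells n (Suc m) = rows_cells n m @ row_cells n 0 (Suc m)"
  by (simp add: rows_cells_def)

lemma reading_order_eq: "reading_order n = rows_cells n n"
  by (simp add: reading_order_def rows_cells_def row_cells_def[abs_def] del: upt_Suc)

text \<open>By \<open>out_nonzero\<close>, labels are nonzero exactly on edges to which a tile
  connects, so fitting means matching edges. Both claims are proved together; cells are visited from
  right to left, hence the induction downwards from \<open>k = n\<close>.\<close>

lemma flow_row:
  fixes D :: tile_matrix and h v :: "nat \<Rightarrow> nat" and i k n :: nat
  assumes "k \<le> n"
  defines "s \<equiv> fold (flow_step D) (row_cells n k i) (h, v)"
  shows "fits_run D (row_cells n k i) (h, v) \<longleftrightarrow>
      (\<forall>j\<in>{Suc k..n}. (conn_right (D (i, j)) \<longleftrightarrow> (if j = n then h i \<noteq> 0 else conn_left (D (i, Suc j)))) \<and>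
         (conn_top (D (i, j)) \<longleftrightarrow> v j \<noteq> 0))" (is "?fits k \<longleftrightarrow> ?conn k")
    and "fits_run D (row_cells n k i) (h, v) \<Longrightarrow>
      (\<forall>r. r \<noteq> i \<longrightarrow> fst s r = h r) \<and>
      (fst s i \<noteq> 0 \<longleftrightarrow> (if k = n then h i \<noteq> 0 else conn_left (D (i, Suc k)))) \<and>
      (\<forall>j. snd s j \<noteq> 0 \<longleftrightarrow> (if j \<in> {Suc k..n} then conn_bottom (D (i, j)) else v j \<noteq> 0))"
proof -
  let ?s = "\<lambda>k. fold (flow_step D) (row_cells n k i) (h, v)"
  let ?state = "\<lambda>k. (\<forall>r. r \<noteq> i \<longrightarrow> fst (?s k) r = h r) \<and>
      (fst (?s k) i \<noteq> 0 \<longleftrightarrow> (if k = n then h i \<noteq> 0 else conn_left (D (i, Suc k)))) \<and>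
      (\<forall>j. snd (?s k) j \<noteq> 0 \<longleftrightarrow> (if j \<in> {Suc k..n} then conn_bottom (D (i, j)) else v j \<noteq> 0))"
  have "(?fits k \<longleftrightarrow> ?conn k) \<and> (?fits k \<longrightarrow> ?state k)"
    using assms(1)
  proof (induction k rule: inc_induct)
    case base
    show ?case by (simp add: row_cells_full)
  next
    case (step k)
    obtain h' v' where s: "?s (Suc k) = (h', v')" by force
    have fits: "?fits k \<longleftrightarrow> ?fits (Suc k) \<and> fits (D (i, Suc k)) (v' (Suc k)) (h' i)"
      by (simp add: row_cells_step[OF step.hyps(2)] fits_run_append s)
    have s': "?s k = flow_step D (i, Suc k) (h', v')"
      by (simp add: row_cells_step[OF step.hyps(2)] s)
    have atLeast: "{Suc k..n} = insert (Suc k) {Suc (Suc k)..n}"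
      using step.hyps by auto
    have conn: "?conn k \<longleftrightarrow> ?conn (Suc k) \<and>
        (conn_right (D (i, Suc k)) \<longleftrightarrow> (if Suc k = n then h i \<noteq> 0 else conn_left (D (i, Suc (Suc k))))) \<and>
         (conn_top (D (i, Suc k)) \<longleftrightarrow> v (Suc k) \<noteq> 0)"
      unfolding atLeast by blast
    show ?case
    proof (cases "?fits (Suc k)")
      case False
      with step.IH fits conn show ?thesis by blast
    next
      case True
      then have st: "?state (Suc k)" using step.IH by blast
      then have "fits (D (i, Suc k)) (v' (Suc k)) (h' i) \<longleftrightarrow>
          (conn_right (D (i, Suc k)) \<longleftrightarrow> (if Suc k = n then h i \<noteq> 0 else conn_left (D (i, Suc (Suc k))))) \<and>
         (conn_top (D (i, Suc k)) \<longleftrightarrow> v (Suc k) \<noteq> 0)"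
        by (simp add: s fits_def del: conn_left.simps conn_right.simps conn_top.simps) blast
      moreover have "?state k" if "fits (D (i, Suc k)) (v' (Suc k)) (h' i)"
        using st out_nonzero[OF that] step.hyps
        by (auto simp: s s' simp del: conn_left.simps conn_right.simps conn_top.simps conn_bottom.simps)
      moreover have "?conn (Suc k)" using True step.IH by blast
      ultimately show ?thesis unfolding conn fits using True by blast
    qed
  qed
  then show "?fits k \<longleftrightarrow> ?conn k" and "?fits k \<Longrightarrow> (\<forall>r. r \<noteq> i \<longrightarrow> fst s r = h r) \<and>
      (fst s i \<noteq> 0 \<longleftrightarrow> (if k = n then h i \<noteq> 0 else conn_left (D (i, Suc k)))) \<and>
      (\<forall>j. snd s j \<noteq> 0 \<longleftrightarrow> (if j \<in> {Suc k..n} then conn_bottom (D (i, j)) else v j \<noteq> 0))"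
    unfolding s_def by blast+
qed

abbreviation flow :: "nat \<Rightarrow> tile_matrix \<Rightarrow> nat \<Rightarrow> (nat \<Rightarrow> nat) \<times> (nat \<Rightarrow> nat)" where
  "flow n D m \<equiv> fold (flow_step D) (rows_cells n m) (\<lambda>i. i, \<lambda>_. 0)"

abbreviation flow_fits :: "nat \<Rightarrow> tile_matrix \<Rightarrow> nat \<Rightarrow> bool" where
  "flow_fits n D m \<equiv> fits_run D (rows_cells n m) (\<lambda>i. i, \<lambda>_. 0)"

lemma flow_rows:
  assumes "n \<ge> 1"
  shows "(flow_fits n D m \<longleftrightarrow> (\<forall>i\<in>{1..m}. \<forall>j\<in>{1..n}.
        (conn_right (D (i, j)) \<longleftrightarrow> j = n \<or> conn_left (D (i, Suc j))) \<and>
        (conn_top (D (i, j)) \<longleftrightarrow> i \<noteq> 1 \<and> conn_bottom (D (i - 1, j))))) \<and>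
    (flow_fits n D m \<longrightarrow>
      (\<forall>i. fst (flow n D m) i \<noteq> 0 \<longleftrightarrow> (if i \<in> {1..m} then conn_left (D (i, 1)) else i \<noteq> 0)) \<and>
      (\<forall>j. snd (flow n D m) j \<noteq> 0 \<longleftrightarrow> m \<noteq> 0 \<and> j \<in> {1..n} \<and> conn_bottom (D (m, j))))"
  (is "(_ \<longleftrightarrow> ?conn m) \<and> (_ \<longrightarrow> ?state m)")
proof (induction m)
  case 0
  show ?case by (simp add: rows_cells_0)
next
  case (Suc m)
  obtain h v where s: "flow n D m = (h, v)" by force
  have fits: "flow_fits n D (Suc m) \<longleftrightarrow> flow_fits n D m \<and> fits_run D (row_cells n 0 (Suc m)) (h, v)"
    by (simp add: rows_cells_Suc fits_run_append s)
  have s': "flow n D (Suc m) = fold (flow_step D) (row_cells n 0 (Suc m)) (h, v)"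
    by (simp add: rows_cells_Suc s)
  have atLeast: "{1..Suc m} = insert (Suc m) {1..m}" by auto
  show ?case
  proof (cases "flow_fits n D m")
    case False
    then show ?thesis using Suc.IH fits unfolding atLeast by blast
  next
    case True
    then have st: "?state m" and conn: "?conn m" using Suc.IH by (blast, blast)
    have conn_Suc: "?conn (Suc m) \<longleftrightarrow> (\<forall>j\<in>{1..n}.
        (conn_right (D (Suc m, j)) \<longleftrightarrow> j = n \<or> conn_left (D (Suc m, Suc j))) \<and>
        (conn_top (D (Suc m, j)) \<longleftrightarrow> Suc m \<noteq> 1 \<and> conn_bottom (D (Suc m - 1, j)))) \<and> ?conn m"
      by (simp only: atLeast ball_simps)
    have h: "h (Suc m) \<noteq> 0" using st by (simp add: s)
    have v: "v j \<noteq> 0 \<longleftrightarrow> m \<noteq> 0 \<and> j \<in> {1..n} \<and> conn_bottom (D (m, j))" for j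
      using st by (simp add: s)
    have row: "fits_run D (row_cells n 0 (Suc m)) (h, v) \<longleftrightarrow> (\<forall>j\<in>{1..n}.
        (conn_right (D (Suc m, j)) \<longleftrightarrow> j = n \<or> conn_left (D (Suc m, Suc j))) \<and>
        (conn_top (D (Suc m, j)) \<longleftrightarrow> Suc m \<noteq> 1 \<and> conn_bottom (D (Suc m - 1, j))))"
      unfolding flow_row(1)[OF le0]
    proof (rule ball_cong)
      fix j assume "j \<in> {1..n}"
      then show "((conn_right (D (Suc m, j)) \<longleftrightarrow> (if j = n then h (Suc m) \<noteq> 0 else conn_left (D (Suc m, Suc j)))) \<and>
          (conn_top (D (Suc m, j)) \<longleftrightarrow> v j \<noteq> 0)) \<longleftrightarrow>
        ((conn_right (D (Suc m, j)) \<longleftrightarrow> j = n \<or> conn_left (D (Suc m, Suc j))) \<and>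
          (conn_top (D (Suc m, j)) \<longleftrightarrow> Suc m \<noteq> 1 \<and> conn_bottom (D (Suc m - 1, j))))"
        using v[of j] h
        by (simp del: conn_left.simps conn_right.simps conn_top.simps conn_bottom.simps)
    qed simp
    have "?state (Suc m)" if "fits_run D (row_cells n 0 (Suc m)) (h, v)"
    proof -
      note row_state = flow_row(2)[OF le0 that]
      have "fst (flow n D (Suc m)) i \<noteq> 0 \<longleftrightarrow> (if i \<in> {1..Suc m} then conn_left (D (i, 1)) else i \<noteq> 0)" for i
      proof (cases "i = Suc m")
        case True
        then show ?thesis using row_state assms unfolding s' by simp
      next
        case False
        then have "fst (flow n D (Suc m)) i = h i" "i \<in> {1..Suc m} \<longleftrightarrow> i \<in> {1..m}"
          using row_state unfolding s' by auto
        then show ?thesis using st by (simp only: s fst_conv)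
      qed
      moreover have "snd (flow n D (Suc m)) j \<noteq> 0 \<longleftrightarrow> j \<in> {1..n} \<and> conn_bottom (D (Suc m, j))" for j
        using conjunct2[OF conjunct2[OF row_state], rule_format, of j] v[of j] unfolding s'
        by (auto simp del: conn_bottom.simps)
      ultimately show ?thesis by blast
    qed
    from this[OF conjunct2[OF iffD1[OF fits]]] have "flow_fits n D (Suc m) \<longrightarrow> ?state (Suc m)"
      by (rule impI)
    moreover have "flow_fits n D (Suc m) \<longleftrightarrow> ?conn (Suc m)"
      unfolding fits row conn_Suc by (intro iffI conjI True conn; elim conjE; assumption)
    ultimately show ?thesis by (rule conjI[rotated])
  qed
qed

text \<open>\<open>flow_fits\<close> already contains the matching conditions and the upper and
  right borders; the left and lower borders are read off the final labels.\<close>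

lemma MBPD_iff_flow:
  assumes "n \<ge> 1"
  shows "D \<in> MBPD n \<longleftrightarrow> D \<in> {1..n} \<times> {1..n} \<rightarrow>\<^sub>E UNIV \<and> flow_fits n D n \<and>
    (\<forall>i\<in>{1..n}. fst (flow n D n) i = 0) \<and> (\<forall>j\<in>{1..n}. snd (flow n D n) j \<noteq> 0)"
proof -
  note flow = flow_rows[OF assms, of D n]
  note [simp del] = conn_left.simps conn_right.simps conn_top.simps conn_bottom.simps
  have first: "(\<forall>i\<in>{1..n}. P i) \<longleftrightarrow> P 1 \<and> (\<forall>i\<in>{1..<n}. P (Suc i))" for P
  proof -
    have "{1..n} = insert 1 (Suc ` {1..<n})"
      using assms by (auto simp: image_Suc_atLeastLessThan)
    then show ?thesis by (simp only: ball_simps)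
  qed
  have last: "(\<forall>i\<in>{1..n}. P i) \<longleftrightarrow> P n \<and> (\<forall>i\<in>{1..<n}. P i)" for P
  proof -
    have "{1..n} = insert n {1..<n}"
      using assms by auto
    then show ?thesis by (simp only: ball_simps)
  qed
  have "(\<forall>j\<in>{1..n}. conn_right (D (i, j)) \<longleftrightarrow> j = n \<or> conn_left (D (i, Suc j))) \<longleftrightarrow>
      (\<forall>j\<in>{1..<n}. conn_right (D (i, j)) \<longleftrightarrow> conn_left (D (i, Suc j))) \<and> conn_right (D (i, n))" for i
    unfolding last by auto
  then have right: "(\<forall>i\<in>{1..n}. \<forall>j\<in>{1..n}. conn_right (D (i, j)) \<longleftrightarrow> j = n \<or> conn_left (D (i, Suc j))) \<longleftrightarrow>
      (\<forall>i\<in>{1..n}. \<forall>j\<in>{1..<n}. conn_right (D (i, j)) \<longleftrightarrow> conn_left (D (i, Suc j))) \<and>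
      (\<forall>i\<in>{1..n}. conn_right (D (i, n)))"
    by blast
  have top: "(\<forall>i\<in>{1..n}. \<forall>j\<in>{1..n}. conn_top (D (i, j)) \<longleftrightarrow> i \<noteq> 1 \<and> conn_bottom (D (i - 1, j))) \<longleftrightarrow>
      (\<forall>i\<in>{1..<n}. \<forall>j\<in>{1..n}. conn_bottom (D (i, j)) \<longleftrightarrow> conn_top (D (Suc i, j))) \<and>
      (\<forall>j\<in>{1..n}. \<not> conn_top (D (1, j)))"
    unfolding first[of "\<lambda>i. \<forall>j\<in>{1..n}. conn_top (D (i, j)) \<longleftrightarrow> i \<noteq> 1 \<and> conn_bottom (D (i - 1, j))"]
    by auto
  have fits: "flow_fits n D n \<longleftrightarrow>
      (\<forall>i\<in>{1..n}. \<forall>j\<in>{1..n}. conn_right (D (i, j)) \<longleftrightarrow> j = n \<or> conn_left (D (i, Suc j))) \<and>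
      (\<forall>i\<in>{1..n}. \<forall>j\<in>{1..n}. conn_top (D (i, j)) \<longleftrightarrow> i \<noteq> 1 \<and> conn_bottom (D (i - 1, j)))"
    using flow by blast
  have "D \<in> MBPD n \<longleftrightarrow> D \<in> {1..n} \<times> {1..n} \<rightarrow>\<^sub>E UNIV \<and> flow_fits n D n \<and>
      (\<forall>i\<in>{1..n}. \<not> conn_left (D (i, 1))) \<and> (\<forall>j\<in>{1..n}. conn_bottom (D (n, j)))"
    unfolding MBPD_def mem_Collect_eq fits right top
    by (rule iffI; elim conjE; intro conjI; assumption)
  also have "\<dots> \<longleftrightarrow> D \<in> {1..n} \<times> {1..n} \<rightarrow>\<^sub>E UNIV \<and> flow_fits n D n \<and>
    (\<forall>i\<in>{1..n}. fst (flow n D n) i = 0) \<and> (\<forall>j\<in>{1..n}. snd (flow n D n) j \<noteq> 0)"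
  proof (intro conj_cong refl ball_cong)
    assume "flow_fits n D n"
    then have st: "\<forall>i. fst (flow n D n) i \<noteq> 0 \<longleftrightarrow> (if i \<in> {1..n} then conn_left (D (i, 1)) else i \<noteq> 0)"
      "\<forall>j. snd (flow n D n) j \<noteq> 0 \<longleftrightarrow> n \<noteq> 0 \<and> j \<in> {1..n} \<and> conn_bottom (D (n, j))"
      using flow by (blast, blast)
    show "\<not> conn_left (D (i, 1)) \<longleftrightarrow> fst (flow n D n) i = 0" if "i \<in> {1..n}" for i
      using st(1)[rule_format, of i] that by (simp only: if_True) blast
    show "conn_bottom (D (n, j)) \<longleftrightarrow> snd (flow n D n) j \<noteq> 0" if "j \<in> {1..n}" for j
      using st(2)[rule_format, of j] that assms by auto
  qed
  finally show ?thesis .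
qed

section \<open>Crossings and inversions\<close>

text \<open>Inversions are recorded by values and as unordered pairs, to be comparable with the
  crossings stored in a \<open>pipe_state\<close>.\<close>

fun inv_pairs :: "nat list \<Rightarrow> nat set set" where
  "inv_pairs [] = {}"
| "inv_pairs (x # xs) = (\<lambda>y. {x, y}) ` {y \<in> set xs. y < x} \<union> inv_pairs xs"

lemma inv_pairs_append:
  "inv_pairs (xs @ ys) = inv_pairs xs \<union> inv_pairs ys \<union> {{x, y} |x y. x \<in> set xs \<and> y \<in> set ys \<and> y < x}"
  by (induction xs) auto

lemma inv_pairs_subset: "e \<in> inv_pairs xs \<Longrightarrow> e \<subseteq> set xs"
  by (induction xs) auto

lemma inv_pairs_swap:
  assumes "t < r" "distinct (xs @ [t, r] @ ys)"
  shows "inv_pairs (xs @ [r, t] @ ys) = insert {t, r} (inv_pairs (xs @ [t, r] @ ys))"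
    and "{t, r} \<notin> inv_pairs (xs @ [t, r] @ ys)"
proof -
  show "inv_pairs (xs @ [r, t] @ ys) = insert {t, r} (inv_pairs (xs @ [t, r] @ ys))"
    using assms(1) by (auto simp: inv_pairs_append)
  show "{t, r} \<notin> inv_pairs (xs @ [t, r] @ ys)"
    using assms by (auto simp: inv_pairs_append doubleton_eq_iff dest: inv_pairs_subset)
qed

lemma inv_pairs_adjacent: "r < t \<Longrightarrow> {t, r} \<in> inv_pairs (xs @ [t, r] @ ys)"
  by (auto simp: inv_pairs_append)

lemma inv_pairs_snoc_max: "\<forall>x\<in>set xs. x < y \<Longrightarrow> inv_pairs (xs @ [y]) = inv_pairs xs"
  by (auto simp: inv_pairs_append)

lemma inv_pairs_map: "inv_pairs (map u [1..<Suc n]) = (\<lambda>(p, q). {u p, u q}) ` inversions n u"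
proof (induction n)
  case (Suc n)
  have "inversions (Suc n) u = inversions n u \<union> (\<lambda>p. (p, Suc n)) ` {p \<in> {1..n}. u (Suc n) < u p}"
    by (auto simp: inversions_def image_iff le_Suc_eq)
  moreover have "map u [1..<Suc (Suc n)] = map u [1..<Suc n] @ [u (Suc n)]" by simp
  moreover have "{{x, y} |x y. x \<in> set (map u [1..<Suc n]) \<and> y \<in> set [u (Suc n)] \<and> y < x} =
      (\<lambda>p. {u p, u (Suc n)}) ` {p \<in> {1..n}. u (Suc n) < u p}"
  proof -
    have "set (map u [1..<Suc n]) = u ` {1..n}" by (auto simp: less_Suc_eq_le simp del: upt_Suc)
    then show ?thesis by (simp only:) auto
  qed
  ultimately show ?case
    by (simp only: inv_pairs_append Suc.IH image_Un image_image prod.case inv_pairs.simps) simp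
qed (auto simp: inversions_def)

lemma card_inv_pairs_map:
  assumes "inj_on u {1..n}"
  shows "card (inv_pairs (map u [1..<Suc n])) = card (inversions n u)"
proof -
  have "inj_on (\<lambda>(p, q). {u p, u q}) (inversions n u)"
  proof (rule inj_onI, clarify)
    fix p q p' q'
    assume pq: "(p, q) \<in> inversions n u" "(p', q') \<in> inversions n u" "{u p, u q} = {u p', u q'}"
    then have "u p = u p'" "u q = u q'"
      by (auto simp: inversions_def doubleton_eq_iff)
    moreover have "p \<in> {1..n}" "q \<in> {1..n}" "p' \<in> {1..n}" "q' \<in> {1..n}"
      using pq by (auto simp: inversions_def)
    ultimately show "p = p' \<and> q = q'"
      using assms by (metis inj_onD)
  qed
  then show ?thesis unfolding inv_pairs_map by (rule card_image)
qed

text \<open>The pipes on the boundary of the visited region, read from north-west to south-east just before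
  cell \<open>(i, k)\<close> is visited, where \<open>a\<close> is the label on its right edge. Only crossings at
  \<^const>\<open>Plus\<close> tiles change this list.\<close>

definition frontier :: "nat \<Rightarrow> nat \<Rightarrow> nat \<Rightarrow> (nat \<Rightarrow> nat) \<Rightarrow> nat list" where
  "frontier n k a v = filter (\<lambda>p. p \<noteq> 0) (map v [1..<Suc k] @ [a] @ map v [Suc k..<Suc n])"

text \<open>The invariant linking the rule that remembers crossings (\<open>s\<close>) with the
  max/min rule (\<open>s'\<close>): two pipes have crossed exactly if they are inverted in the
  frontier \<open>F\<close>. Labels are compared only on edges with a pipe, as the trace keeps stale
  values elsewhere.\<close>

definition tracks :: "nat \<Rightarrow> nat list \<Rightarrow> pipe_state \<Rightarrow> (nat \<Rightarrow> nat) \<times> (nat \<Rightarrow> nat) \<Rightarrow> bool" where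
  "tracks i F s s' \<longleftrightarrow>
     (\<forall>j. snd s' j \<noteq> 0 \<longrightarrow> fst (snd s) j = snd s' j) \<and>
     (fst s' i \<noteq> 0 \<longrightarrow> fst s i = fst s' i) \<and> (\<forall>r>i. fst s r = r \<and> fst s' r = r) \<and>
     distinct F \<and> set F = {1..i} \<and> distinct (snd (snd s)) \<and> set (snd (snd s)) = inv_pairs F"

text \<open>At a plus tile the top label and the right label are neighbours in the frontier. If they
  are in increasing order, the pipes have not crossed; they cross now, which swaps the two entries
  and adds one inversion. Otherwise they have crossed, and the bump leaves the frontier unchanged,
  as max/min does.\<close>

lemma tracks_step:
  assumes "tracks i (frontier n (Suc k) (fst s' i) (snd s')) s s'" "k < n"
    and "fits (D (i, Suc k)) (snd s' (Suc k)) (fst s' i)"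
  defines "t \<equiv> flow_step D (i, Suc k) s'"
  shows "tracks i (frontier n k (fst t i) (snd t)) (pipe_step True D (i, Suc k) s) t"
proof -
  obtain h v X where s: "s = (h, v, X)" by (metis prod_cases3)
  obtain h' v' where s': "s' = (h', v')" by force
  define xs where "xs = filter (\<lambda>p. p \<noteq> 0) (map v' [1..<Suc k])"
  define ys where "ys = filter (\<lambda>p. p \<noteq> 0) (map v' [Suc (Suc k)..<Suc n])"
  let ?nz = "filter (\<lambda>p :: nat. p \<noteq> 0)" and ?T = "D (i, Suc k)"
  let ?t = "v' (Suc k)" and ?r = "h' i"
  let ?l = "out_left ?T ?t ?r" and ?b = "out_bottom ?T ?t ?r"
  have upt: "[1..<Suc (Suc k)] = [1..<Suc k] @ [Suc k]" "[Suc k..<Suc n] = Suc k # [Suc (Suc k)..<Suc n]"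
    using assms(2) by (simp, simp add: upt_conv_Cons del: upt_Suc)
  have F: "frontier n (Suc k) (h' i) v' = xs @ ?nz [?t] @ ?nz [?r] @ ys"
    unfolding frontier_def upt(1) xs_def ys_def by simp
  have "map (v'(Suc k := ?b)) [1..<Suc k] = map v' [1..<Suc k]"
    "map (v'(Suc k := ?b)) [Suc (Suc k)..<Suc n] = map v' [Suc (Suc k)..<Suc n]"
    by (simp_all del: upt_Suc)
  then have F': "frontier n k ?l (v'(Suc k := ?b)) = xs @ ?nz [?l] @ ?nz [?b] @ ys"
    unfolding frontier_def upt(2) xs_def ys_def by simp
  have t: "t = (h'(i := ?l), v'(Suc k := ?b))"
    by (simp add: t_def s')
  have tr: "\<And>j. v' j \<noteq> 0 \<Longrightarrow> v j = v' j" "h' i \<noteq> 0 \<Longrightarrow> h i = h' i" "\<forall>r>i. h r = r \<and> h' r = r"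
    "distinct (xs @ ?nz [?t] @ ?nz [?r] @ ys)" "set (xs @ ?nz [?t] @ ?nz [?r] @ ys) = {1..i}"
    "distinct X" "set X = inv_pairs (xs @ ?nz [?t] @ ?nz [?r] @ ys)"
    using assms(1) unfolding tracks_def s s' fst_conv snd_conv F by blast+
  have "tracks i (xs @ ?nz [?l] @ ?nz [?b] @ ys) (pipe_step True D (i, Suc k) (h, v, X)) t"
  proof (cases "?T = Plus")
    case False
    then have "xs @ ?nz [?l] @ ?nz [?b] @ ys = xs @ ?nz [?t] @ ?nz [?r] @ ys"
      "snd (snd (pipe_step True D (i, Suc k) (h, v, X))) = X"
      using assms(3) by (cases ?T; auto simp: s' fits_def)+
    moreover have "(v'(Suc k := ?b)) j \<noteq> 0 \<longrightarrow> fst (snd (pipe_step True D (i, Suc k) (h, v, X))) j = (v'(Suc k := ?b)) j" for j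
      using False assms(3) tr(1,2) by (cases ?T; auto simp: s' fits_def)
    moreover have "(h'(i := ?l)) i \<noteq> 0 \<longrightarrow> fst (pipe_step True D (i, Suc k) (h, v, X)) i = (h'(i := ?l)) i"
      using False assms(3) tr(1,2) by (cases ?T; auto simp: s' fits_def)
    moreover have "\<forall>r>i. fst (pipe_step True D (i, Suc k) (h, v, X)) r = r \<and> (h'(i := ?l)) r = r"
      using False tr(3) by (cases ?T; auto)
    ultimately show ?thesis
      unfolding tracks_def t fst_conv snd_conv using tr(4-7) by presburger
  next
    case True
    then have nz: "?t \<noteq> 0" "?r \<noteq> 0"
      using assms(3) by (auto simp: s' fits_def)
    then have eq: "v (Suc k) = ?t" "h i = ?r" using tr by auto
    have dist: "distinct (xs @ [?t, ?r] @ ys)" using tr(4) nz by simp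
    have X: "set X = inv_pairs (xs @ [?t, ?r] @ ys)" using tr(7) nz by simp
    have set: "set (xs @ [?t, ?r] @ ys) = {1..i}" using tr(5) nz by simp
    consider "?t < ?r" | "?r < ?t" using dist by fastforce
    then show ?thesis
    proof cases
      case 1
      have "{?t, ?r} \<notin> set X"
        unfolding X by (rule inv_pairs_swap[OF 1 dist])
      moreover have "inv_pairs (xs @ [?r, ?t] @ ys) = insert {?t, ?r} (set X)"
        unfolding X by (rule inv_pairs_swap[OF 1 dist])
      ultimately show ?thesis
        using 1 True nz eq tr(1-3,6) dist set
        by (auto simp: tracks_def t insert_commute)
    next
      case 2
      have "{?t, ?r} \<in> set X"
        unfolding X by (rule inv_pairs_adjacent[OF 2])
      then show ?thesis
        using 2 True nz eq tr(1-3,6) dist set X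
        by (auto simp: tracks_def t insert_commute)
    qed
  qed
  then show ?thesis
    unfolding s t fst_conv snd_conv fun_upd_same F' .
qed

lemma tracks_row:
  assumes "tracks i (frontier n n (fst s' i) (snd s')) s s'" "k \<le> n"
    and "fits_run D (row_cells n k i) s'"
  defines "t \<equiv> fold (flow_step D) (row_cells n k i) s'"
  shows "tracks i (frontier n k (fst t i) (snd t)) (fold (pipe_step True D) (row_cells n k i) s) t"
  unfolding t_def using assms(2,3)
proof (induction k rule: inc_induct)
  case base
  then show ?case using assms(1) by (simp add: row_cells_full)
next
  case (step k)
  obtain h' v' where "fold (flow_step D) (row_cells n (Suc k) i) s' = (h', v')" by force
  with step show ?case
    using tracks_step[of i n k "(h', v')" _ D]
    by (simp add: row_cells_step fits_run_append del: flow_step.simps pipe_step.simps)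
qed

abbreviation trace :: "bool \<Rightarrow> nat \<Rightarrow> tile_matrix \<Rightarrow> nat \<Rightarrow> pipe_state" where
  "trace bump n D m \<equiv> fold (pipe_step bump D) (rows_cells n m) (\<lambda>i. i, \<lambda>_. 0, [])"

lemma pipe_trace_eq: "pipe_trace bump n D = trace bump n D n"
  by (simp add: pipe_trace_def reading_order_eq)

text \<open>A new row appends its pipe, the largest label so far, at the end of the frontier without
  creating inversions. After the row the left edge is empty, so only vertical labels remain.\<close>

lemma tracks_rows:
  assumes "flow_fits n D m" "\<And>i. i \<in> {1..m} \<Longrightarrow> \<not> conn_left (D (i, 1))" "n \<ge> 1"
  shows "tracks m (filter (\<lambda>p. p \<noteq> 0) (map (snd (flow n D m)) [1..<Suc n])) (trace True n D m) (flow n D m)"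
  using assms(1,2)
proof (induction m)
  case 0
  show ?case by (auto simp: tracks_def rows_cells_0 simp del: upt_Suc)
next
  case (Suc m)
  let ?s = "trace True n D m" and ?s' = "flow n D m"
  let ?F = "filter (\<lambda>p. p \<noteq> 0) (map (snd ?s') [1..<Suc n])"
  have fits: "flow_fits n D m" "fits_run D (row_cells n 0 (Suc m)) ?s'"
    using Suc.prems(1) by (auto simp: rows_cells_Suc fits_run_append)
  have tr: "tracks m ?F ?s ?s'" using Suc fits by auto
  have h: "fst ?s (Suc m) = Suc m" "fst ?s' (Suc m) = Suc m"
    using tr by (auto simp: tracks_def)
  have F: "frontier n n (Suc m) (snd ?s') = ?F @ [Suc m]"
    by (simp add: frontier_def)
  have "set ?F = {1..m}" using tr unfolding tracks_def by blast
  then have "inv_pairs (?F @ [Suc m]) = inv_pairs ?F" "set (?F @ [Suc m]) = {1..Suc m}" "Suc m \<notin> set ?F"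
  proof -
    assume F: "set ?F = {1..m}"
    show "inv_pairs (?F @ [Suc m]) = inv_pairs ?F"
      by (rule inv_pairs_snoc_max) (simp only: F, simp)
    show "set (?F @ [Suc m]) = {1..Suc m}" "Suc m \<notin> set ?F"
      unfolding set_append F by auto
  qed
  then have "tracks (Suc m) (frontier n n (fst ?s' (Suc m)) (snd ?s')) ?s ?s'"
    using tr h unfolding h F tracks_def
    by (simp del: upt_Suc set_filter set_map set_append)
  from tracks_row[OF this le0 fits(2)]
  have "tracks (Suc m) (frontier n 0 (fst (flow n D (Suc m)) (Suc m)) (snd (flow n D (Suc m))))
      (trace True n D (Suc m)) (flow n D (Suc m))"
    by (simp only: rows_cells_Suc fold_append o_apply)
  moreover have "fst (flow n D (Suc m)) (Suc m) = 0"
  proof -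
    have "\<forall>i. fst (flow n D (Suc m)) i \<noteq> 0 \<longleftrightarrow> (if i \<in> {1..Suc m} then conn_left (D (i, 1)) else i \<noteq> 0)"
      using flow_rows[OF assms(3), of D "Suc m"] Suc.prems(1) by blast
    from this[rule_format, of "Suc m"] show ?thesis
      using Suc.prems(2)[of "Suc m"] by (simp del: conn_left.simps)
  qed
  ultimately show ?case by (simp add: frontier_def del: upt_Suc)
qed

section \<open>Bumps versus repeated meetings of straight pipes\<close>

definition plus_count :: "tile_matrix \<Rightarrow> (nat \<times> nat) list \<Rightarrow> nat" where
  "plus_count D cs = length (filter (\<lambda>c. D c = Plus) cs)"

text \<open>The runs coincide until the first bump, and up to there each plus tile adds one entry.
  At that bump the straight run records some pair \<open>e\<close> a second time while the other run
  adds nothing, and this discrepancy persists.\<close>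

lemma trace_compare:
  fixes D cs h v
  defines "s \<equiv> fold (pipe_step True D) cs (h, v, [])" and "s' \<equiv> fold (pipe_step False D) cs (h, v, [])"
  shows "(s = s' \<and> length (snd (snd s)) = plus_count D cs) \<or>
     (length (snd (snd s)) < plus_count D cs \<and>
       (\<exists>e\<in>set (snd (snd s)). count_list (snd (snd s')) e \<ge> 2))"
  unfolding s_def s'_def
proof (induction cs rule: rev_induct)
  case Nil
  show ?case by (simp add: plus_count_def)
next
  case (snoc c cs)
  obtain i j where c: "c = (i, j)" by force
  obtain h1 v1 X where s: "fold (pipe_step True D) cs (h, v, []) = (h1, v1, X)"
    by (metis prod_cases3)
  obtain h1' v1' X' where s': "fold (pipe_step False D) cs (h, v, []) = (h1', v1', X')"
    by (metis prod_cases3)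
  note state = s s'
  show ?case
  proof (cases "D c = Plus")
    case False
    then have "plus_count D (cs @ [c]) = plus_count D cs"
      "snd (snd (pipe_step b D c (h2, v2, X2))) = X2"
      "(h1, v1, X) = (h1', v1', X') \<Longrightarrow> pipe_step True D c (h1, v1, X) = pipe_step False D c (h1', v1', X')"
      for b h2 v2 X2
      by (cases "D c"; simp add: c plus_count_def)+
    then show ?thesis
      using snoc unfolding fold_append fold_simps o_apply state by (metis snd_conv)
  next
    case True
    let ?e = "{h1 i, v1 j}"
    have plus: "plus_count D (cs @ [c]) = Suc (plus_count D cs)"
      using True by (simp add: plus_count_def)
    have X: "snd (snd (pipe_step True D c (h1, v1, X))) = (if ?e \<in> set X then X else X @ [?e])"
      "snd (snd (pipe_step False D c (h1', v1', X'))) = X' @ [{h1' i, v1' j}]"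
      using True by (simp_all add: c)
    from snoc consider (eq) "(h1, v1, X) = (h1', v1', X')" "length X = plus_count D cs"
      | (less) e where "length X < plus_count D cs" "e \<in> set X" "count_list X' e \<ge> 2"
      unfolding state by auto
    then show ?thesis
    proof cases
      case eq
      show ?thesis
      proof (cases "?e \<in> set X")
        case in_X: True
        then have "count_list X ?e \<noteq> 0" by (simp add: count_list_0_iff)
        then have "count_list (X' @ [{h1' i, v1' j}]) ?e \<ge> 2" using eq by simp
        then show ?thesis
          using in_X eq unfolding fold_append fold_simps o_apply state X plus by auto
      next
        case False
        then have "pipe_step True D c (h1, v1, X) = pipe_step False D c (h1', v1', X')"
          using eq True by (simp add: c)
        then show ?thesis
          using False eq X(1) unfolding fold_append fold_simps o_apply state plus by simp
      qed
    next
      case less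
      then have "count_list (X' @ [{h1' i, v1' j}]) e \<ge> 2" by simp
      then show ?thesis
        using less unfolding fold_append fold_simps o_apply state X plus
        by (intro disjI2 conjI bexI[of _ e]) simp_all
    qed
  qed
qed

section \<open>Weights and the bijection\<close>

text \<open>At the end the frontier is the list of bottom labels, a permutation whose inversions are
  the recorded crossings. The labels map columns to pipes, which explains the inverse.\<close>

lemma MBPD_run:
  assumes "n \<ge> 1" "D \<in> MBPD n"
  defines "v \<equiv> snd (flow n D n)" and "X \<equiv> snd (snd (trace True n D n))"
  defines "u \<equiv> \<lambda>j. if j \<in> {1..n} then v j else j"
  shows "u permutes {1..n}" "perm_MBPD n D = inv u"
    "length X = coxeter_length n (perm_MBPD n D)" "distinct X"
    "\<And>e. e \<in> set X \<Longrightarrow> \<exists>p\<in>{1..n}. \<exists>q\<in>{1..n}. p \<noteq> q \<and> e = {p, q}"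
proof -
  have D: "flow_fits n D n" "\<forall>j\<in>{1..n}. v j \<noteq> 0"
    using assms MBPD_iff_flow by auto
  moreover have "\<not> conn_left (D (i, 1))" if "i \<in> {1..n}" for i
    using assms(2) that unfolding MBPD_def by blast
  ultimately have tr: "tracks n (filter (\<lambda>p. p \<noteq> 0) (map v [1..<Suc n])) (trace True n D n) (flow n D n)"
    unfolding v_def using assms(1) by (intro tracks_rows)
  have "filter (\<lambda>p. p \<noteq> 0) (map v [1..<Suc n]) = map v [1..<Suc n]"
    using D(2) by (intro filter_True) (auto simp del: upt_Suc)
  note tr = tr[unfolded this tracks_def]
  have exit: "exit_pipe n D j = v j" if "j \<in> {1..n}" for j
    using tr D(2) that by (simp add: exit_pipe_def pipe_trace_eq v_def)
  have set_upt: "set [1..<Suc n] = {1..n}" by auto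
  have inj: "inj_on v {1..n}"
    using tr unfolding distinct_map set_upt by blast
  have img: "v ` {1..n} = {1..n}"
    using tr unfolding set_map set_upt by blast
  have "bij_betw v {1..n} {1..n}"
    using inj img by (simp add: bij_betw_def)
  then have "bij_betw u {1..n} {1..n}"
    by (rule bij_betw_cong[THEN iffD1, rotated]) (simp add: u_def)
  then show u: "u permutes {1..n}"
    by (rule bij_imp_permutes) (auto simp: u_def)
  show perm: "perm_MBPD n D = inv u"
  proof
    fix i
    show "perm_MBPD n D i = inv u i"
    proof (cases "i \<in> {1..n}")
      case True
      then have i: "inv u i \<in> {1..n}" "u (inv u i) = i"
        using permutes_in_image[OF permutes_inv[OF u]] permutes_inverses[OF u] by auto
      have "(THE j. j \<in> {1..n} \<and> exit_pipe n D j = i) = inv u i"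
      proof (rule the_equality)
        show "inv u i \<in> {1..n} \<and> exit_pipe n D (inv u i) = i"
          using i exit[of "inv u i"] by (simp add: u_def)
        fix j assume "j \<in> {1..n} \<and> exit_pipe n D j = i"
        then have "u j = i" using exit[of j] by (simp add: u_def)
        then show "j = inv u i" using permutes_inverses[OF u] by auto
      qed
      then show ?thesis using True by (simp add: perm_MBPD_def)
    next
      case False
      then show ?thesis
        using permutes_not_in[OF permutes_inv[OF u] False] by (simp only: perm_MBPD_def if_False)
    qed
  qed
  have X: "distinct X" "set X = inv_pairs (map v [1..<Suc n])"
    using tr unfolding X_def by blast+
  then show "distinct X" by blast
  have "inversions n v = inversions n u"
    by (auto simp: inversions_def u_def)
  then have "length X = card (inversions n u)"
    using X card_inv_pairs_map[OF inj] by (metis distinct_card)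
  then show "length X = coxeter_length n (perm_MBPD n D)"
    unfolding perm by (simp add: coxeter_length_eq[OF permutes_inv[OF u]] permutes_inv_inv[OF u])
  fix e assume "e \<in> set X"
  then obtain p q where "(p, q) \<in> inversions n v" "e = {v p, v q}"
    unfolding X(2) inv_pairs_map by auto
  moreover from this have "v p \<in> v ` {1..n}" "v q \<in> v ` {1..n}" "v p \<noteq> v q"
    by (auto simp: inversions_def)
  ultimately show "\<exists>p\<in>{1..n}. \<exists>q\<in>{1..n}. p \<noteq> q \<and> e = {p, q}"
    unfolding img by blast
qed

text \<open>Flow conservation: in each row one pipe enters from the right and none leaves to the
  left, so each row adds one vertical edge.\<close>

lemma top_edges_count:
  fixes T B L R :: "nat \<Rightarrow> nat \<Rightarrow> int"
  assumes "\<And>i j. i \<in> {1..n} \<Longrightarrow> j \<in> {1..n} \<Longrightarrow> R i j + T i j = L i j + B i j"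
    and "\<And>i j. i \<in> {1..n} \<Longrightarrow> j \<in> {1..<n} \<Longrightarrow> R i j = L i (Suc j)" "\<And>i. i \<in> {1..n} \<Longrightarrow> R i n = 1"
    and "\<And>i j. i \<in> {1..<n} \<Longrightarrow> j \<in> {1..n} \<Longrightarrow> B i j = T (Suc i) j" "\<And>j. j \<in> {1..n} \<Longrightarrow> T 1 j = 0"
    and "\<And>i. i \<in> {1..n} \<Longrightarrow> L i 1 = 0"
  shows "i \<in> {1..n} \<Longrightarrow> (\<Sum>j=1..n. T i j) = int i - 1" "i \<in> {1..n} \<Longrightarrow> (\<Sum>j=1..n. B i j) = int i"
proof -
  have step: "(\<Sum>j=1..n. B i j) = (\<Sum>j=1..n. T i j) + 1" if "i \<in> {1..n}" for i
  proof -
    \<comment> \<open>Extends \<open>L\<close> beyond the right border, where the value 1 is the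
      entering pipe, so that the sum telescopes.\<close>
    let ?E = "\<lambda>j. if j = Suc n then 1 else L i j"
    have "(\<Sum>j=1..n. B i j) - (\<Sum>j=1..n. T i j) = (\<Sum>j=1..n. R i j - L i j)"
      unfolding sum_subtractf[symmetric] using assms(1)[OF that] by (intro sum.cong) (auto simp: algebra_simps)
    also have "\<dots> = (\<Sum>j=1..n. ?E (Suc j) - ?E j)"
    proof (rule sum.cong)
      fix j assume "j \<in> {1..n}"
      then show "R i j - L i j = ?E (Suc j) - ?E j"
        using assms(2)[OF that, of j] assms(3)[OF that] by (cases "j = n") auto
    qed simp
    also have "\<dots> = ?E (Suc n) - ?E 1"
      by (rule sum_Suc_diff) simp
    also have "\<dots> = 1" using assms(6)[OF that] that by simp
    finally show ?thesis by simp
  qed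
  have T: "(\<Sum>j=1..n. T i j) = int i - 1" if "1 \<le> i" "i \<le> n" for i
    using that
  proof (induction i rule: dec_induct)
    case base
    then show ?case using assms(5) by simp
  next
    case (step i)
    have "(\<Sum>j=1..n. T (Suc i) j) = (\<Sum>j=1..n. B i j)"
      using step.hyps step.prems assms(4)[of i] by (intro sum.cong) auto
    with step \<open>\<And>i. i \<in> {1..n} \<Longrightarrow> (\<Sum>j=1..n. B i j) = (\<Sum>j=1..n. T i j) + 1\<close>[of i]
    show ?case by simp
  qed
  show "i \<in> {1..n} \<Longrightarrow> (\<Sum>j=1..n. T i j) = int i - 1" "i \<in> {1..n} \<Longrightarrow> (\<Sum>j=1..n. B i j) = int i"
    using T[of i] step[of i] by auto
qed

text \<open>Tile by tile, blank minus plus equals one minus the right and top connections. The sums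
  of these over the grid cancel by the edge counts.\<close>

lemma card_Blank_eq_card_Plus:
  assumes "D \<in> MBPD n"
  shows "card {c \<in> {1..n} \<times> {1..n}. D c = Blank} = card {c \<in> {1..n} \<times> {1..n}. D c = Plus}"
proof -
  let ?T = "\<lambda>i j. of_bool (conn_top (D (i, j))) :: int" and ?B = "\<lambda>i j. of_bool (conn_bottom (D (i, j))) :: int"
  let ?L = "\<lambda>i j. of_bool (conn_left (D (i, j))) :: int" and ?R = "\<lambda>i j. of_bool (conn_right (D (i, j))) :: int"
  have D: "\<And>i j. i \<in> {1..n} \<Longrightarrow> j \<in> {1..<n} \<Longrightarrow> conn_right (D (i, j)) \<longleftrightarrow> conn_left (D (i, Suc j))"
    "\<And>i j. i \<in> {1..<n} \<Longrightarrow> j \<in> {1..n} \<Longrightarrow> conn_bottom (D (i, j)) \<longleftrightarrow> conn_top (D (Suc i, j))"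
    "\<And>i. i \<in> {1..n} \<Longrightarrow> conn_right (D (i, n))" "\<And>j. j \<in> {1..n} \<Longrightarrow> conn_bottom (D (n, j))"
    "\<And>j. j \<in> {1..n} \<Longrightarrow> \<not> conn_top (D (1, j))" "\<And>i. i \<in> {1..n} \<Longrightarrow> \<not> conn_left (D (i, 1))"
    using assms unfolding MBPD_def by blast+
  have conserve: "?R i j + ?T i j = ?L i j + ?B i j" for i j
    by (cases "D (i, j)") auto
  have T: "(\<Sum>j=1..n. ?T i j) = int i - 1" if "i \<in> {1..n}" for i
    using that D conserve
    by (intro top_edges_count(1)[where B = ?B and L = ?L and R = ?R])
      (simp_all del: conn_left.simps conn_right.simps conn_top.simps conn_bottom.simps)
  \<comment> \<open>The same count after reflection in the main diagonal: columns act as rows, with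
    left and right edges in place of top and bottom.\<close>
  have R: "(\<Sum>i=1..n. ?R i j) = int j" if "j \<in> {1..n}" for j
    using that D conserve
    by (intro top_edges_count(2)[where T = "\<lambda>j i. ?L i j" and B = "\<lambda>j i. ?R i j" and L = "\<lambda>j i. ?T i j" and R = "\<lambda>j i. ?B i j"])
      (simp_all del: conn_left.simps conn_right.simps conn_top.simps conn_bottom.simps add: add.commute)
  have "int (card {c \<in> {1..n} \<times> {1..n}. D c = Blank}) - int (card {c \<in> {1..n} \<times> {1..n}. D c = Plus}) =
      (\<Sum>c\<in>{1..n} \<times> {1..n}. of_bool (D c = Blank) - of_bool (D c = Plus))"
    by (simp add: sum_subtractf sum_of_bool_eq Int_def)
  also have "\<dots> = (\<Sum>(i, j)\<in>{1..n} \<times> {1..n}. 1 - ?R i j - ?T i j)"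
  proof (rule sum.cong, simp, clarify)
    fix i j
    show "of_bool (D (i, j) = Blank) - of_bool (D (i, j) = Plus) = 1 - ?R i j - ?T i j"
      by (cases "D (i, j)") auto
  qed
  also have "\<dots> = (\<Sum>i=1..n. \<Sum>j=1..n. 1) - (\<Sum>i=1..n. \<Sum>j=1..n. ?R i j) - (\<Sum>i=1..n. \<Sum>j=1..n. ?T i j)"
    by (simp only: sum.cartesian_product[symmetric] sum_subtractf)
  also have "(\<Sum>i=1..n. \<Sum>j=1..n. ?R i j) = (\<Sum>j=1..n. int j)"
    by (subst sum.swap) (use R in simp)
  also have "(\<Sum>i=1..n. \<Sum>j=1..n. ?T i j) = (\<Sum>i=1..n. int i - 1)"
    using T by simp
  also have "(\<Sum>i=1..n. \<Sum>j=1..n. 1) - (\<Sum>j=1..n. int j) - (\<Sum>i=1..n. int i - 1) = 0"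
  proof -
    have "(\<Sum>j=1..n. int j) + (\<Sum>i=1..n. int i - 1) = int n * int n"
      by (induction n) (auto simp: algebra_simps)
    then show ?thesis by simp
  qed
  finally show ?thesis by simp
qed

lemma sum_list_wt_MBPD:
  assumes "D \<in> MBPD n"
  shows "sum_list (wt_MBPD n D) =
    card {c \<in> {1..n} \<times> {1..n}. D c = Plus} + card {c \<in> {1..n} \<times> {1..n}. D c = MarkedJ}"
proof -
  have "sum_list (wt_MBPD n D) = (\<Sum>i=1..n. card {j \<in> {1..n}. heavy (D (i, j))})"
    unfolding wt_MBPD_def by (simp add: sum_list_distinct_conv_sum_set atLeastLessThanSuc_atLeastAtMost del: upt_Suc)
  also have "\<dots> = card (SIGMA i:{1..n}. {j \<in> {1..n}. heavy (D (i, j))})"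
    by (subst card_SigmaI) auto
  also have "(SIGMA i:{1..n}. {j \<in> {1..n}. heavy (D (i, j))}) =
      {c \<in> {1..n} \<times> {1..n}. D c = Blank} \<union> {c \<in> {1..n} \<times> {1..n}. D c = MarkedJ}"
    by (auto simp: heavy_def)
  also have "card \<dots> = card {c \<in> {1..n} \<times> {1..n}. D c = Blank} + card {c \<in> {1..n} \<times> {1..n}. D c = MarkedJ}"
    by (intro card_Un_disjoint) auto
  finally show ?thesis by (simp only: card_Blank_eq_card_Plus[OF assms])
qed

lemma count_list_le_1: "distinct xs \<Longrightarrow> count_list xs y \<le> 1"
  by (induction xs) (auto simp: count_list_0_iff)

text \<open>The total weight is the number of plus tiles plus the number of marks, and the Coxeter
  length is the number of genuine crossings. Equality therefore means no marks and no bumps, and the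
  latter is reducedness by \<open>trace_compare\<close>.\<close>

lemma reduced_unmarked_iff:
  assumes "n \<ge> 1" "D \<in> MBPD n"
  shows "reduced_MBPD n D \<and> unmarked n D \<longleftrightarrow> sum_list (wt_MBPD n D) = coxeter_length n (perm_MBPD n D)"
proof -
  let ?X = "snd (snd (trace True n D n))"
  note X = MBPD_run(3-5)[OF assms]
  have straight: "straight_meetings n D = snd (snd (trace False n D n))"
    by (simp add: straight_meetings_def pipe_trace_eq)
  have "plus_count D (rows_cells n n) = card {c \<in> {1..n} \<times> {1..n}. D c = Plus}"
  proof -
    have "plus_count D (reading_order n) = card (set (filter (\<lambda>c. D c = Plus) (reading_order n)))"
      unfolding plus_count_def by (rule distinct_card[symmetric]) (simp add: distinct_reading_order)
    then show ?thesis by (simp add: set_reading_order reading_order_eq[symmetric])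
  qed
  note wt = sum_list_wt_MBPD[OF assms(2), folded this]
  let ?plus = "plus_count D (rows_cells n n)"
  let ?marked = "card {c \<in> {1..n} \<times> {1..n}. D c = MarkedJ}"
  have unmarked: "unmarked n D \<longleftrightarrow> ?marked = 0"
    by (auto simp: unmarked_def)
  note compare = trace_compare[of D "rows_cells n n" "\<lambda>i. i" "\<lambda>_. 0"]
  have le: "length ?X \<le> ?plus" using compare by linarith
  have "reduced_MBPD n D \<longleftrightarrow> length ?X = ?plus"
  proof
    assume red: "reduced_MBPD n D"
    have "count_list (straight_meetings n D) e \<le> 1" if "e \<in> set ?X" for e
      using X(3)[OF that] red unfolding reduced_MBPD_def by blast
    then have "\<not> (\<exists>e\<in>set ?X. count_list (snd (snd (trace False n D n))) e \<ge> 2)"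
      unfolding straight by fastforce
    then show "length ?X = ?plus" using compare by blast
  next
    assume "length ?X = ?plus"
    then have "straight_meetings n D = ?X" using compare straight by auto
    then have "count_list (straight_meetings n D) e \<le> 1" for e
      using X(2) by (simp only: count_list_le_1)
    then show "reduced_MBPD n D" unfolding reduced_MBPD_def by blast
  qed
  then show ?thesis unfolding unmarked wt X(1)[symmetric] using le by linarith
qed

section \<open>Weights as monomials\<close>

lemma wt_MBPD_nth: "i \<in> {1..n} \<Longrightarrow> wt_MBPD n D ! (i - 1) = card {j \<in> {1..n}. heavy (D (i, j))}"
  unfolding wt_MBPD_def by (subst nth_map_upt) auto

lemma wt_RCP_nth: "i \<in> {1..n} \<Longrightarrow> wt_RCP n B ! (i - 1) = length (filter (\<lambda>b. fst b = i) B)"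
  unfolding wt_RCP_def by (subst nth_map_upt) auto

lemma sum_list_wt_RCP:
  assumes "set B \<subseteq> biletters n"
  shows "sum_list (wt_RCP n B) = length B"
proof -
  have "(\<Sum>i=1..n. length (filter (\<lambda>b. fst b = i) B)) = length B"
    using assms
  proof (induction B)
    case (Cons b B)
    have "(\<Sum>i=1..n. length (filter (\<lambda>b. fst b = i) (b # B))) =
        (\<Sum>i=1..n. of_bool (i = fst b) + length (filter (\<lambda>b. fst b = i) B))"
      by (intro sum.cong) auto
    also have "\<dots> = Suc (length B)"
      using Cons by (auto simp: sum.distrib biletters_def of_bool_def)
    finally show ?case by simp
  qed simp
  then show ?thesis
    by (simp add: wt_RCP_def sum_list_distinct_conv_sum_set atLeastLessThanSuc_atLeastAtMost del: upt_Suc)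
qed

lemma reduced_RCP_iff:
  assumes "B \<in> RCP n"
  shows "reduced_RCP n B \<longleftrightarrow> sum_list (wt_RCP n B) = coxeter_length n (perm_RCP n B)"
  using assms by (simp add: reduced_RCP_def RCP_def sum_list_wt_RCP)

definition weight_monomial :: "nat \<Rightarrow> (nat \<Rightarrow> 'a::comm_semiring_1) \<Rightarrow> nat list \<Rightarrow> 'a" where
  "weight_monomial n x ms = (\<Prod>i=1..n. x i ^ (ms ! (i - 1)))"

lemma weight_monomial_MBPD:
  "weight_monomial n x (wt_MBPD n D) = (\<Prod>c\<in>{1..n} \<times> {1..n}. tile_wt (x (fst c)) (D c))"
proof -
  have "(\<Prod>j=1..n. tile_wt (x i) (D (i, j))) = x i ^ card {j \<in> {1..n}. heavy (D (i, j))}" for i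
    unfolding tile_wt_def by (subst prod.inter_filter[symmetric]) (simp_all only: finite_atLeastAtMost prod_constant)
  then have "weight_monomial n x (wt_MBPD n D) = (\<Prod>i=1..n. \<Prod>j=1..n. tile_wt (x i) (D (i, j)))"
    unfolding weight_monomial_def by (intro prod.cong) (simp_all only: wt_MBPD_nth)
  then show ?thesis
    by (simp add: prod.cartesian_product case_prod_beta)
qed

lemma weight_monomial_RCP:
  assumes "set B \<subseteq> biletters n"
  shows "weight_monomial n x (wt_RCP n B) = prod_list (map (\<lambda>b. x (fst b)) B)"
proof -
  have "(\<Prod>i=1..n. x i ^ length (filter (\<lambda>b. fst b = i) B)) = prod_list (map (\<lambda>b. x (fst b)) B)"
    using assms
  proof (induction B)
    case (Cons b B)
    have "(\<Prod>i=1..n. x i ^ length (filter (\<lambda>b. fst b = i) (b # B))) =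
        (\<Prod>i=1..n. (if i = fst b then x i else 1) * x i ^ length (filter (\<lambda>b. fst b = i) B))"
      by (intro prod.cong) auto
    also have "\<dots> = x (fst b) * prod_list (map (\<lambda>b. x (fst b)) B)"
      using Cons by (auto simp: prod.distrib biletters_def)
    finally show ?case by simp
  qed simp
  moreover have "weight_monomial n x (wt_RCP n B) = (\<Prod>i=1..n. x i ^ length (filter (\<lambda>b. fst b = i) B))"
    unfolding weight_monomial_def by (intro prod.cong) (simp_all only: wt_RCP_nth)
  ultimately show ?thesis by simp
qed

lemma finite_MBPD: "finite (MBPD n)"
proof (rule finite_subset)
  show "MBPD n \<subseteq> {1..n} \<times> {1..n} \<rightarrow>\<^sub>E UNIV" by (auto simp: MBPD_def)
qed (auto intro!: finite_PiE)

text \<open>The arbitrary function \<open>f\<close> keeps track of the permutation, so that single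
  permutations can be isolated later.\<close>

theorem generating_functions_eq:
  fixes x :: "nat \<Rightarrow> 'a::comm_semiring_1"
  assumes "n \<ge> 1"
  shows "(\<Sum>D\<in>MBPD n. weight_monomial n x (wt_MBPD n D) * f (perm_MBPD n D)) =
    (\<Sum>B\<in>RCP n. weight_monomial n x (wt_RCP n B) * f (perm_RCP n B))"
proof -
  let ?ext = "\<lambda>v j. if j \<in> {1..n} then v j else j :: nat"
  \<comment> \<open>The observable imposes the empty left and full lower borders and reads off the
    permutation as the inverse of the bottom labels.\<close>
  define g where "g h v = (if (\<forall>i\<in>{1..n}. h i = 0) \<and> (\<forall>j\<in>{1..n}. v j \<noteq> 0) then f (inv (?ext v)) else 0)"
    for h v :: "nat \<Rightarrow> nat"
  let ?W = "\<lambda>D. \<Prod>c\<in>{1..n} \<times> {1..n}. tile_wt (x (fst c)) (D c)"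
  have "(\<Sum>D\<in>MBPD n. weight_monomial n x (wt_MBPD n D) * f (perm_MBPD n D)) =
      (\<Sum>D\<in>MBPD n. ?W D * case_prod g (flow n D n))"
  proof (rule sum.cong)
    fix D assume D: "D \<in> MBPD n"
    then have "case_prod g (flow n D n) = f (perm_MBPD n D)"
      using MBPD_iff_flow[OF assms, of D] MBPD_run(2)[OF assms D]
      by (simp add: g_def case_prod_beta)
    then show "weight_monomial n x (wt_MBPD n D) * f (perm_MBPD n D) = ?W D * case_prod g (flow n D n)"
      by (simp add: weight_monomial_MBPD)
  qed simp
  \<comment> \<open>Fitting tilings that violate a border condition are sent to 0 by
    \<open>g\<close>.\<close>
  also have "\<dots> = (\<Sum>D\<in>{1..n} \<times> {1..n} \<rightarrow>\<^sub>E UNIV. if flow_fits n D n then ?W D * case_prod g (flow n D n) else 0)"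
  proof (rule sum.mono_neutral_cong_left)
    show "finite ({1..n} \<times> {1..n} \<rightarrow>\<^sub>E (UNIV :: tile set))" by (auto intro!: finite_PiE)
    show "MBPD n \<subseteq> {1..n} \<times> {1..n} \<rightarrow>\<^sub>E UNIV" by (auto simp: MBPD_def)
    show "\<forall>D\<in>({1..n} \<times> {1..n} \<rightarrow>\<^sub>E UNIV) - MBPD n.
        (if flow_fits n D n then ?W D * case_prod g (flow n D n) else 0) = 0"
      using MBPD_iff_flow[OF assms] by (auto simp: g_def case_prod_beta)
  qed (use MBPD_iff_flow[OF assms] in auto)
  also have "\<dots> = grid_gf n 0 x g (\<lambda>i. i) (\<lambda>_. 0)"
    unfolding grid_gf_eq_cells cells_eq_sum[OF distinct_reading_order] set_reading_order
    by (simp only: reading_order_eq)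
  also have "\<dots> = words_gf n 0 x (\<lambda>u. g (\<lambda>i. if i \<in> {Suc 0..n} then 0 else i)
      (\<lambda>j. if j \<in> {Suc 0..n} then u j else 0)) (\<lambda>i. i)"
    by (intro grid_gf_eq_words_gf) (auto simp: g_def h_closed_def v_full_def Ball_def)
  also have "\<dots> = (\<Sum>B\<in>RCP n. weight_monomial n x (wt_RCP n B) * f (perm_RCP n B))"
    unfolding words_gf_eq_sum_RCP[unfolded id_def]
  proof (rule sum.cong)
    fix B assume B: "B \<in> RCP n"
    let ?u = "inv (perm_RCP n B)"
    have "perm_RCP n B permutes {1..n}"
      using B unfolding perm_RCP_def by (intro demazure_word_permutes permutes_id) (auto simp: RCP_def)
    then have u: "?u permutes {1..n}" "inv ?u = perm_RCP n B"
      by (auto intro: permutes_inv permutes_inv_inv)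
    have "?u j \<noteq> 0" if "j \<in> {1..n}" for j
      using permutes_in_image[OF u(1), of j] that by auto
    moreover have "?ext (\<lambda>j. if j \<in> {Suc 0..n} then ?u j else 0) = ?u"
      using permutes_not_in[OF u(1)] by auto
    ultimately have "g (\<lambda>i. if i \<in> {Suc 0..n} then 0 else i) (\<lambda>j. if j \<in> {Suc 0..n} then ?u j else 0) = f (perm_RCP n B)"
      using u(2) unfolding g_def by simp
    then show "prod_list (map (\<lambda>b. x (fst b)) B) * g (\<lambda>i. if i \<in> {Suc 0..n} then 0 else i)
        (\<lambda>j. if j \<in> {Suc 0..n} then ?u j else 0) =
      weight_monomial n x (wt_RCP n B) * f (perm_RCP n B)"
      using B by (simp add: weight_monomial_RCP RCP_def)
  qed simp
  finally show ?thesis .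
qed

section \<open>Extracting coefficients\<close>

definition exponent :: "nat \<Rightarrow> nat list \<Rightarrow> nat \<Rightarrow>\<^sub>0 nat" where
  "exponent n ms = (\<Sum>i=1..n. Poly_Mapping.single i (ms ! (i - 1)))"

lemma exponent_inject:
  assumes "length ms = n" "length ms' = n"
  shows "exponent n ms = exponent n ms' \<longleftrightarrow> ms = ms'"
proof
  have lookup: "Poly_Mapping.lookup (exponent n ms) i = ms ! (i - 1)" if "i \<in> {1..n}" for i ms
    using that by (simp add: exponent_def lookup_sum lookup_single when_def)
  assume eq: "exponent n ms = exponent n ms'"
  show "ms = ms'"
  proof (rule nth_equalityI)
    fix i assume "i < length ms"
    then show "ms ! i = ms' ! i"
      using lookup[of "Suc i" ms] lookup[of "Suc i" ms'] eq assms by simp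
  qed (use assms in simp)
qed simp

text \<open>\<open>Poly_Mapping.single (Poly_Mapping.single i 1) 1\<close> is the
  \<open>i\<close>-th variable of the polynomial semiring over \<open>nat\<close>.\<close>

lemma weight_monomial_single:
  "weight_monomial n (\<lambda>i. Poly_Mapping.single (Poly_Mapping.single i 1) (1 :: nat)) ms =
    Poly_Mapping.single (exponent n ms) 1"
proof -
  have one: "Poly_Mapping.single 0 (Suc 0) = 1"
    using single_one by (metis One_nat_def)
  have power: "Poly_Mapping.single (Poly_Mapping.single i (1 :: nat)) (1 :: nat) ^ m =
      Poly_Mapping.single (Poly_Mapping.single i m) 1" for i :: nat and m
    by (induction m) (simp_all add: one mult_single single_add[symmetric])
  have "(\<Prod>i\<in>A. Poly_Mapping.single (Poly_Mapping.single i (ms ! (i - 1))) (1 :: nat)) =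
      Poly_Mapping.single (\<Sum>i\<in>A. Poly_Mapping.single i (ms ! (i - 1))) 1" if "finite A" for A
    using that by induction (simp_all add: one mult_single)
  then show ?thesis by (simp only: weight_monomial_def exponent_def power finite_atLeastAtMost)
qed

text \<open>With variables for \<open>x\<close> and the indicator of \<open>w\<close> for
  \<open>f\<close>, the coefficient at the exponent \<open>ms\<close> counts the fibre over
  \<open>(ms, w)\<close>.\<close>

lemma card_fibres_eq:
  assumes "n \<ge> 1"
  shows "card {D \<in> MBPD n. (wt_MBPD n D, perm_MBPD n D) = (ms, w)} =
    card {B \<in> RCP n. (wt_RCP n B, perm_RCP n B) = (ms, w)}"
proof (cases "length ms = n")
  case True
  have count: "Poly_Mapping.lookup (\<Sum>a\<in>A. Poly_Mapping.single (exponent n (wt a)) (1 :: nat) * of_bool (perm a = w)) (exponent n ms) =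
      card {a \<in> A. (wt a, perm a) = (ms, w)}"
    if "finite A" "\<And>a. length (wt a) = n" for A :: "'b set" and wt and perm :: "'b \<Rightarrow> nat \<Rightarrow> nat"
  proof -
    have "Poly_Mapping.lookup (Poly_Mapping.single (exponent n (wt a)) (1 :: nat) * of_bool (perm a = w)) (exponent n ms) =
        of_bool ((wt a, perm a) = (ms, w))" for a
      using that(2) True by (auto simp: lookup_single when_def exponent_inject)
    note lookup = this
    show ?thesis
      unfolding lookup_sum lookup using that(1) by (simp add: sum_of_bool_eq Int_def)
  qed
  have "length (wt_MBPD n D) = n" "length (wt_RCP n B) = n" for D B
    by (simp_all add: wt_MBPD_def wt_RCP_def)
  then show ?thesis
    using generating_functions_eq[OF assms, of "\<lambda>i. Poly_Mapping.single (Poly_Mapping.single i (1 :: nat)) (1 :: nat)"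
        "\<lambda>w'. of_bool (w' = w)"]
    unfolding weight_monomial_single by (simp only: count[OF finite_MBPD, symmetric] count[OF finite_RCP, symmetric])
next
  case False
  moreover have "length (wt_MBPD n D) = n" "length (wt_RCP n B) = n" for D B
    by (simp_all add: wt_MBPD_def wt_RCP_def)
  ultimately have "{D \<in> MBPD n. (wt_MBPD n D, perm_MBPD n D) = (ms, w)} = {}"
    "{B \<in> RCP n. (wt_RCP n B, perm_RCP n B) = (ms, w)} = {}" by auto
  then show ?thesis by (simp only: card.empty)
qed

text \<open>Bijections between corresponding fibres are chosen and glued.\<close>

lemma bij_betw_of_card_fibres_eq:
  assumes "finite A" "finite B" "\<And>k. card {a \<in> A. p a = k} = card {b \<in> B. q b = k}"
  obtains f where "bij_betw f A B" "\<And>a. a \<in> A \<Longrightarrow> q (f a) = p a"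
proof -
  have "\<exists>f. bij_betw f {a \<in> A. p a = k} {b \<in> B. q b = k}" for k
    using assms by (intro finite_same_card_bij) auto
  then obtain F where F: "\<And>k. bij_betw (F k) {a \<in> A. p a = k} {b \<in> B. q b = k}" by metis
  define f where "f a = F (p a) a" for a
  have f: "f a \<in> B" "q (f a) = p a" if "a \<in> A" for a
    using bij_betwE[OF F[of "p a"]] that by (auto simp: f_def)
  have "bij_betw f A B"
  proof (rule bij_betw_imageI)
    show "inj_on f A"
    proof (rule inj_onI)
      fix a a' assume *: "a \<in> A" "a' \<in> A" "f a = f a'"
      then have "p a = p a'" using f by metis
      then show "a = a'"
        using * bij_betw_imp_inj_on[OF F[of "p a"]] by (auto simp: f_def inj_on_def)
    qed
    show "f ` A = B"
    proof
      show "B \<subseteq> f ` A"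
      proof
        fix b assume "b \<in> B"
        then have "b \<in> F (q b) ` {a \<in> A. p a = q b}"
          using bij_betw_imp_surj_on[OF F[of "q b"]] by auto
        then show "b \<in> f ` A" unfolding f_def by force
      qed
    qed (use f in auto)
  qed
  with f show ?thesis using that by blast
qed

theorem theorem1p2:
  fixes n :: nat
  assumes "n \<ge> 1"
  shows "\<exists>\<Phi> \<Psi>.
    bij_betw \<Phi> (MBPD n) (RCP n) \<and>
    bij_betw \<Psi> (RCP n) (MBPD n) \<and>
    (\<forall>D\<in>MBPD n. \<Psi> (\<Phi> D) = D) \<and>
    (\<forall>B\<in>RCP n. \<Phi> (\<Psi> B) = B) \<and>
    (\<forall>D\<in>MBPD n. wt_RCP n (\<Phi> D) = wt_MBPD n D \<and> perm_RCP n (\<Phi> D) = perm_MBPD n D) \<and>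
    (\<forall>B\<in>RCP n. wt_MBPD n (\<Psi> B) = wt_RCP n B \<and> perm_MBPD n (\<Psi> B) = perm_RCP n B) \<and>
    bij_betw \<Phi> {D \<in> MBPD n. reduced_MBPD n D \<and> unmarked n D} {B \<in> RCP n. reduced_RCP n B} \<and>
    bij_betw \<Psi> {B \<in> RCP n. reduced_RCP n B} {D \<in> MBPD n. reduced_MBPD n D \<and> unmarked n D}"
proof -
  have "card {D \<in> MBPD n. (wt_MBPD n D, perm_MBPD n D) = k} =
      card {B \<in> RCP n. (wt_RCP n B, perm_RCP n B) = k}" for k
    using card_fibres_eq[OF assms, of "fst k" "snd k"] by simp
  from bij_betw_of_card_fibres_eq[OF finite_MBPD finite_RCP this]
  obtain \<Phi> where \<Phi>: "bij_betw \<Phi> (MBPD n) (RCP n)"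
    "\<And>D. D \<in> MBPD n \<Longrightarrow> (wt_RCP n (\<Phi> D), perm_RCP n (\<Phi> D)) = (wt_MBPD n D, perm_MBPD n D)"
    by blast
  define \<Psi> where "\<Psi> = the_inv_into (MBPD n) \<Phi>"
  have \<Psi>: "bij_betw \<Psi> (RCP n) (MBPD n)"
    unfolding \<Psi>_def using \<Phi>(1) by (rule bij_betw_the_inv_into)
  have left: "\<Psi> (\<Phi> D) = D" if "D \<in> MBPD n" for D
    unfolding \<Psi>_def using \<Phi>(1) that by (intro the_inv_into_f_f) (auto simp: bij_betw_def)
  have right: "\<Phi> (\<Psi> B) = B" if "B \<in> RCP n" for B
    unfolding \<Psi>_def using \<Phi>(1) that by (simp add: f_the_inv_into_f_bij_betw[of _ "MBPD n"])
  have \<Phi>_in: "\<Phi> D \<in> RCP n" if "D \<in> MBPD n" for D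
    using \<Phi>(1) that by (auto simp: bij_betw_def)
  have \<Psi>_in: "\<Psi> B \<in> MBPD n" if "B \<in> RCP n" for B
    using \<Psi> that by (auto simp: bij_betw_def)
  \<comment> \<open>Both properties say that total weight equals Coxeter length, and
    \<open>\<Phi>\<close> preserves weight and permutation.\<close>
  have reduced: "reduced_RCP n (\<Phi> D) \<longleftrightarrow> reduced_MBPD n D \<and> unmarked n D" if "D \<in> MBPD n" for D
    using reduced_unmarked_iff[OF assms that] reduced_RCP_iff[OF \<Phi>_in[OF that]] \<Phi>(2)[OF that] by simp
  have reduced': "reduced_RCP n B \<longleftrightarrow> reduced_MBPD n (\<Psi> B) \<and> unmarked n (\<Psi> B)" if "B \<in> RCP n" for B
    using reduced[OF \<Psi>_in[OF that]] right[OF that] by simp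
  let ?R = "{D \<in> MBPD n. reduced_MBPD n D \<and> unmarked n D}" and ?S = "{B \<in> RCP n. reduced_RCP n B}"
  have "bij_betw \<Phi> ?R ?S"
    by (rule bij_betw_byWitness[where f' = \<Psi>])
      (use left right \<Phi>_in \<Psi>_in reduced reduced' in auto)
  moreover have "bij_betw \<Psi> ?S ?R"
    by (rule bij_betw_byWitness[where f' = \<Phi>])
      (use left right \<Phi>_in \<Psi>_in reduced reduced' in auto)
  moreover have "wt_MBPD n (\<Psi> B) = wt_RCP n B \<and> perm_MBPD n (\<Psi> B) = perm_RCP n B" if "B \<in> RCP n" for B
    using \<Phi>(2)[OF \<Psi>_in[OF that]] right[OF that] by simp
  ultimately show ?thesis
    using \<Phi> \<Psi> left right by (intro exI[of _ \<Phi>] exI[of _ \<Psi>]) auto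
qed

end
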